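(* Let $(\Omega,\mathcal{F},(\mathcal{F}_t)_{t\in[0,T]},\mathbb{P})$ be a filtered probability space, let $(\mathbb{Y},d)$ be a metric space with Borel $\sigma$-algebra $\mathcal{B}_{\mathbb{Y}}$, and fix $1\le p<\infty$. Let $\mathcal{M}$ equal the progressive $\sigma$-algebra $\mathrm{Prog}$ when $(\mathcal{F}_t)_{t\in[0,T]}$ does not necessarily satisfy the usual conditions, and the adapted $\sigma$-algebra $\mathcal{A}$ when it does. Assume that $\operatorname{dens}(\mathbb{Y})$ is strictly smaller than every real-valued measurable cardinal. Then for every $(\mathcal{M},\mathcal{B}_{\mathbb{Y}})$-measurable stochastic process $X\colon(\Omega\times[0,T],\mathcal{M})\to(\mathbb{Y},\mathcal{B}_{\mathbb{Y}})$ satisfying $$\mathbb{E}\Bigl[\int_0^T d(X(\omega,t),y_0)^p\,dt\Bigr]<\infty$$ for some $y_0\in\mathbb{Y}$, and every $\varepsilon>0$, there exists a process $\widetilde X$ of the form $$\widetilde X(\omega,t)=\mathbf{1}_{\{0\}}(t)\,\Xi_0(\omega)+\sum_{i=0}^{n-1}\mathbf{1}_{(t_i,t_{i+1}]}(t)\,\Xi_i(\omega),$$ where $0=t_0<t_1<\dots<t_n=T$ is a partition of $[0,T]$ and, for each $i$, $$\Xi_i(\omega)=\sum_{j=1}^{N}y_{i,j}\,\mathbf{1}_{A_{i,j}}(\omega)$$ for some $y_{i,1},\dots,y_{i,N}\in\mathbb{Y}$ and a partition $A_{i,1},\dots,A_{i,N}\in\mathcal{F}_{t_i}$ of $\Omega$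 (allowing empty cells), such that $$\Bigl(\mathbb{E}\Bigl[\int_0^T d(X(\omega,t),\widetilde X(\omega,t))^p\,dt\Bigr]\Bigr)^{1/p}\le\varepsilon.$$
   Context: The sums of $\mathbb{Y}$-valued terms are formal: no algebraic structure on $\mathbb{Y}$ is used; $\Xi_i(\omega)$ is the value $y_{i,j}$ with $\omega\in A_{i,j}$, and $\widetilde X(\omega,t)=\Xi_i(\omega)$ for $t\in(t_i,t_{i+1}]$, $\widetilde X(\omega,0)=\Xi_0(\omega)$. A filtration satisfies the usual conditions if it is right-continuous and $\mathcal{F}_0$ contains all $\mathbb{P}$-null sets of $\mathcal{F}$. On $[0,T]\times\Omega$ (identified with $\Omega\times[0,T]$): $\mathcal{A}:=\{A\in\mathcal{B}([0,T])\otimes\mathcal{F}: \{\omega:(t,\omega)\in A\}\in\mathcal{F}_t\ \forall t\in[0,T]\}$, and $\mathrm{Prog}:=\{A\in\mathcal{B}([0,T])\otimes\mathcal{F}: A\cap([0,t]\times\Omega)\in\mathcal{B}([0,t])\otimes\mathcal{F}_t\ \forall t\in[0,T]\}$. The density $\operatorname{dens}(\mathbb{Y})$ is the smallest cardinality of a dense subset of $\mathbb{Y}$. A cardinal $\kappa$ is real-valued measurable if there exist a set $I$ of cardinality $\kappa$ and a countably additive probability measure $\pi$ on all subsets of $I$ such that $\pi(\{x\})=0$ for every $x\in I$ and the union of fewer than $\kappa$ subsets of $\pi$-measure zero has $\pi$-measure zero. *)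

theory Defs
  imports "HOL-Probability.Probability"
begin

unbundle cardinal_syntax

section \<open>Filtered probability spaces over a bounded time interval\<close>

text \<open>Only the \<open>\<F> t\<close> with \<open>t \<in> {0..T}\<close> are meaningful, and only their \<sigma>-algebras are used.\<close>

locale filtered_prob_space = prob_space P
  for P :: "'a measure" and T :: real and \<F> :: "real \<Rightarrow> 'a measure" +
  assumes subalg: "t \<in> {0..T} \<Longrightarrow> subalgebra P (\<F> t)"
    and mono: "0 \<le> s \<Longrightarrow> s \<le> t \<Longrightarrow> t \<le> T \<Longrightarrow> sets (\<F> s) \<subseteq> sets (\<F> t)"

text \<open>\<open>null_sets P\<close> consists of measurable sets; \<open>P\<close> itself need not be complete.\<close>

definition usual_conditions :: "'a measure \<Rightarrow> real \<Rightarrow> (real \<Rightarrow> 'a measure) \<Rightarrow> bool" where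
  "usual_conditions P T \<F> \<longleftrightarrow>
     (\<forall>t\<in>{0..<T}. sets (\<F> t) = (\<Inter>s\<in>{t<..T}. sets (\<F> s))) \<and>
     null_sets P \<subseteq> sets (\<F> 0)"

definition adapted_sets :: "'a measure \<Rightarrow> real \<Rightarrow> (real \<Rightarrow> 'a measure) \<Rightarrow> (real \<times> 'a) set set" where
  "adapted_sets P T \<F> =
     {A \<in> sets (restrict_space borel {0..T} \<Otimes>\<^sub>M P). \<forall>t\<in>{0..T}. {\<omega>. (t, \<omega>) \<in> A} \<in> sets (\<F> t)}"

definition prog_sets :: "'a measure \<Rightarrow> real \<Rightarrow> (real \<Rightarrow> 'a measure) \<Rightarrow> (real \<times> 'a) set set" where
  "prog_sets P T \<F> =
     {A \<in> sets (restrict_space borel {0..T} \<Otimes>\<^sub>M P).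
        \<forall>t\<in>{0..T}. A \<inter> ({0..t} \<times> space P) \<in> sets (restrict_space borel {0..t} \<Otimes>\<^sub>M \<F> t)}"

definition adapted_algebra :: "'a measure \<Rightarrow> real \<Rightarrow> (real \<Rightarrow> 'a measure) \<Rightarrow> (real \<times> 'a) measure" where
  "adapted_algebra P T \<F> = sigma ({0..T} \<times> space P) (adapted_sets P T \<F>)"

definition prog_algebra :: "'a measure \<Rightarrow> real \<Rightarrow> (real \<Rightarrow> 'a measure) \<Rightarrow> (real \<times> 'a) measure" where
  "prog_algebra P T \<F> = sigma ({0..T} \<times> space P) (prog_sets P T \<F>)"

text \<open>Both collections already are \<sigma>-algebras, so \<open>sigma\<close> adds no sets.\<close>

context filtered_prob_space
begin

lemma space_filt: "t \<in> {0..T} \<Longrightarrow> space (\<F> t) = space P"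
  using subalg by (auto simp: subalgebra_def)

lemma sigma_algebra_adapted_sets: "sigma_algebra ({0..T} \<times> space P) (adapted_sets P T \<F>)"
proof -
  let ?B = "restrict_space borel {0..T} \<Otimes>\<^sub>M P"
  have sp: "space ?B = {0..T} \<times> space P"
    by (simp add: space_pair_measure space_restrict_space)
  show ?thesis
  proof (rule sigma_algebra_iff2[THEN iffD2], intro conjI ballI allI impI)
    show "adapted_sets P T \<F> \<subseteq> Pow ({0..T} \<times> space P)"
      using sets.sets_into_space[of _ ?B] by (auto simp: adapted_sets_def sp)
    show "{} \<in> adapted_sets P T \<F>" by (simp add: adapted_sets_def)
  next
    fix A assume A: "A \<in> adapted_sets P T \<F>"
    have "{0..T} \<times> space P - A \<in> sets ?B"
      using A sets.compl_sets[of A ?B] by (simp add: adapted_sets_def sp)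
    moreover have "{\<omega>. (t, \<omega>) \<in> {0..T} \<times> space P - A} \<in> sets (\<F> t)" if t: "t \<in> {0..T}" for t
    proof -
      have "{\<omega>. (t, \<omega>) \<in> {0..T} \<times> space P - A} = space (\<F> t) - {\<omega>. (t, \<omega>) \<in> A}"
        using t space_filt[OF t] by auto
      then show ?thesis using A t by (auto simp: adapted_sets_def)
    qed
    ultimately show "{0..T} \<times> space P - A \<in> adapted_sets P T \<F>"
      by (simp add: adapted_sets_def)
  next
    fix A :: "nat \<Rightarrow> (real \<times> 'a) set" assume A: "range A \<subseteq> adapted_sets P T \<F>"
    have "{\<omega>. (t, \<omega>) \<in> (\<Union>i. A i)} = (\<Union>i. {\<omega>. (t, \<omega>) \<in> A i})" for t
      by auto
    moreover have "(\<Union>i. A i) \<in> sets ?B"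
      using A by (intro sets.countable_UN) (auto simp: adapted_sets_def)
    moreover have "(\<Union>i. {\<omega>. (t, \<omega>) \<in> A i}) \<in> sets (\<F> t)" if "t \<in> {0..T}" for t
      using A that by (intro sets.countable_UN) (auto simp: adapted_sets_def)
    ultimately show "(\<Union>i. A i) \<in> adapted_sets P T \<F>"
      unfolding adapted_sets_def by simp
  qed
qed

lemma sigma_algebra_prog_sets: "sigma_algebra ({0..T} \<times> space P) (prog_sets P T \<F>)"
proof -
  let ?B = "restrict_space borel {0..T} \<Otimes>\<^sub>M P"
  let ?C = "\<lambda>t. restrict_space borel {0..t} \<Otimes>\<^sub>M \<F> t"
  have sp: "space ?B = {0..T} \<times> space P"
    by (simp add: space_pair_measure space_restrict_space)
  have sp_t: "space (?C t) = {0..t} \<times> space P" if "t \<in> {0..T}" for t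
    using that by (simp add: space_pair_measure space_restrict_space space_filt)
  show ?thesis
  proof (rule sigma_algebra_iff2[THEN iffD2], intro conjI ballI allI impI)
    show "prog_sets P T \<F> \<subseteq> Pow ({0..T} \<times> space P)"
      using sets.sets_into_space[of _ ?B] by (auto simp: prog_sets_def sp)
    show "{} \<in> prog_sets P T \<F>" by (simp add: prog_sets_def)
  next
    fix A assume A: "A \<in> prog_sets P T \<F>"
    have "{0..T} \<times> space P - A \<in> sets ?B"
      using A sets.compl_sets[of A ?B] by (simp add: prog_sets_def sp)
    moreover have "({0..T} \<times> space P - A) \<inter> ({0..t} \<times> space P) \<in> sets (?C t)"
      if t: "t \<in> {0..T}" for t
    proof -
      have "({0..T} \<times> space P - A) \<inter> ({0..t} \<times> space P) = space (?C t) - A \<inter> ({0..t} \<times> space P)"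
        using t by (auto simp: sp_t)
      then show ?thesis using A t by (auto simp: prog_sets_def)
    qed
    ultimately show "{0..T} \<times> space P - A \<in> prog_sets P T \<F>"
      by (simp add: prog_sets_def)
  next
    fix A :: "nat \<Rightarrow> (real \<times> 'a) set" assume A: "range A \<subseteq> prog_sets P T \<F>"
    have "(\<Union>i. A i) \<inter> ({0..t} \<times> space P) = (\<Union>i. A i \<inter> ({0..t} \<times> space P))" for t
      by auto
    moreover have "(\<Union>i. A i) \<in> sets ?B"
      using A by (intro sets.countable_UN) (auto simp: prog_sets_def)
    moreover have "(\<Union>i. A i \<inter> ({0..t} \<times> space P)) \<in> sets (?C t)" if "t \<in> {0..T}" for t
      using A that by (intro sets.countable_UN) (auto simp: prog_sets_def)
    ultimately show "(\<Union>i. A i) \<in> prog_sets P T \<F>"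
      unfolding prog_sets_def by simp
  qed
qed

lemma sets_adapted_algebra: "sets (adapted_algebra P T \<F>) = adapted_sets P T \<F>"
  and space_adapted_algebra: "space (adapted_algebra P T \<F>) = {0..T} \<times> space P"
proof -
  interpret sigma_algebra "{0..T} \<times> space P" "adapted_sets P T \<F>"
    by (rule sigma_algebra_adapted_sets)
  show "sets (adapted_algebra P T \<F>) = adapted_sets P T \<F>"
    unfolding adapted_algebra_def by (rule sets_measure_of_eq)
  show "space (adapted_algebra P T \<F>) = {0..T} \<times> space P"
    unfolding adapted_algebra_def by (rule space_measure_of_eq)
qed

lemma sets_prog_algebra: "sets (prog_algebra P T \<F>) = prog_sets P T \<F>"
  and space_prog_algebra: "space (prog_algebra P T \<F>) = {0..T} \<times> space P"
proof -
  interpret sigma_algebra "{0..T} \<times> space P" "prog_sets P T \<F>"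
    by (rule sigma_algebra_prog_sets)
  show "sets (prog_algebra P T \<F>) = prog_sets P T \<F>"
    unfolding prog_algebra_def by (rule sets_measure_of_eq)
  show "space (prog_algebra P T \<F>) = {0..T} \<times> space P"
    unfolding prog_algebra_def by (rule space_measure_of_eq)
qed

end


section \<open>Density and real-valued measurable cardinals\<close>

text \<open>Cardinals are cardinal orders \<open>|A|\<close>, compared with \<open>\<le>o\<close>, \<open><o\<close> and \<open>=o\<close>; these relate
  orders over different types.\<close>

definition dens :: "'b::topological_space itself \<Rightarrow> 'b rel" where
  "dens _ = (SOME \<kappa>. \<exists>D :: 'b set. closure D = UNIV \<and> \<kappa> = |D| \<and>
                      (\<forall>D' :: 'b set. closure D' = UNIV \<longrightarrow> |D| \<le>o |D'| ))"

lemma dens_witness: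
  obtains D :: "'b::topological_space set"
  where "closure D = UNIV" "dens TYPE('b) = |D|"
    "\<And>D' :: 'b set. closure D' = UNIV \<Longrightarrow> |D| \<le>o |D'|"
proof -
  let ?R = "{ |D| | D :: 'b set. closure D = UNIV}"
  have "\<exists>r\<in>?R. \<forall>r'\<in>?R. r \<le>o r'"
  proof (rule exists_minim_Card_order)
    show "?R \<noteq> {}" using closure_UNIV by blast
    show "\<forall>r\<in>?R. Card_order r" using card_of_Card_order by blast
  qed
  then obtain D\<^sub>0 :: "'b set" where "closure D\<^sub>0 = UNIV"
      "\<And>D' :: 'b set. closure D' = UNIV \<Longrightarrow> |D\<^sub>0| \<le>o |D'|"
    by blast
  then have "\<exists>\<kappa>. \<exists>D :: 'b set. closure D = UNIV \<and> \<kappa> = |D| \<and>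
      (\<forall>D' :: 'b set. closure D' = UNIV \<longrightarrow> |D| \<le>o |D'| )"
    by (intro exI[of _ "|D\<^sub>0|"] exI[of _ D\<^sub>0]) simp
  then have "\<exists>D :: 'b set. closure D = UNIV \<and> dens TYPE('b) = |D| \<and>
      (\<forall>D' :: 'b set. closure D' = UNIV \<longrightarrow> |D| \<le>o |D'| )"
    unfolding dens_def by (rule someI_ex)
  then show thesis
    using that by (elim exE conjE) simp
qed

text \<open>The index set is taken inside the type carrying \<open>\<kappa>\<close>, which is no restriction since the
  conditions are invariant under bijections.\<close>

definition real_valued_measurable :: "'b rel \<Rightarrow> bool" where
  "real_valued_measurable \<kappa> \<longleftrightarrow>
     Card_order \<kappa> \<and>
     (\<exists>(I :: 'b set) \<pi>. |I| =o \<kappa> \<and>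
        prob_space \<pi> \<and> space \<pi> = I \<and> sets \<pi> = Pow I \<and>
        (\<forall>x\<in>I. emeasure \<pi> {x} = 0) \<and>
        (\<forall>\<N> \<subseteq> Pow I. |\<N>| <o \<kappa> \<longrightarrow> (\<forall>N\<in>\<N>. emeasure \<pi> N = 0) \<longrightarrow> emeasure \<pi> (\<Union>\<N>) = 0))"

lemma real_valued_measurable_copy:
  fixes \<kappa> :: "'c rel"
  assumes rvm: "real_valued_measurable \<kappa>" and le: "\<kappa> \<le>o |UNIV :: 'b set|"
  obtains \<kappa>' :: "'b rel" where "real_valued_measurable \<kappa>'" "\<kappa>' =o \<kappa>"
proof -
  from rvm obtain I :: "'c set" and \<pi> where I: "|I| =o \<kappa>"
    and \<pi>: "prob_space \<pi>" "space \<pi> = I" "sets \<pi> = Pow I"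
    and pt: "\<And>x. x \<in> I \<Longrightarrow> emeasure \<pi> {x} = 0"
    and un: "\<And>\<N>. \<N> \<subseteq> Pow I \<Longrightarrow> |\<N>| <o \<kappa> \<Longrightarrow> (\<And>N. N \<in> \<N> \<Longrightarrow> emeasure \<pi> N = 0)
                \<Longrightarrow> emeasure \<pi> (\<Union>\<N>) = 0"
    unfolding real_valued_measurable_def by (elim exE conjE) simp
  interpret prob_space \<pi> by fact
  have "|I| \<le>o |UNIV :: 'b set|"
    using I le by (rule ordIso_ordLeq_trans)
  then obtain f :: "'c \<Rightarrow> 'b" where f: "inj_on f I"
    using card_of_ordLeq[of I "UNIV :: 'b set"] by auto
  define \<rho> where "\<rho> = distr \<pi> (count_space (f ` I)) f"
  have meas: "f \<in> \<pi> \<rightarrow>\<^sub>M count_space (f ` I)"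
    by (auto simp: measurable_def \<pi>)
  have em: "emeasure \<rho> A = emeasure \<pi> (f -` A \<inter> I)" if "A \<subseteq> f ` I" for A
    unfolding \<rho>_def using that by (subst emeasure_distr[OF meas]) (auto simp: \<pi>)
  have iso: "|f ` I| =o |I|"
    using f by (meson card_of_ordIso inj_on_imp_bij_betw ordIso_symmetric)
  then have iso': "|f ` I| =o \<kappa>"
    using I by (rule ordIso_transitive)
  have "real_valued_measurable |f ` I|"
    unfolding real_valued_measurable_def
  proof (intro conjI exI[of _ "f ` I"] exI[of _ \<rho>] ballI allI impI)
    show "Card_order |f ` I|" by (rule card_of_Card_order)
    show "|f ` I| =o |f ` I|" by (rule card_of_refl)
    show "prob_space \<rho>" unfolding \<rho>_def by (rule prob_space_distr[OF meas])
    show "space \<rho> = f ` I" "sets \<rho> = Pow (f ` I)" by (simp_all add: \<rho>_def)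
  next
    fix y assume "y \<in> f ` I"
    then obtain x where x: "x \<in> I" "y = f x" by blast
    then have "f -` {y} \<inter> I = {x}" using f by (auto dest: inj_onD)
    then show "emeasure \<rho> {y} = 0" using em[of "{y}"] pt x by auto
  next
    fix \<N> :: "'b set set"
    assume N: "\<N> \<subseteq> Pow (f ` I)" "|\<N>| <o |f ` I|" "\<forall>N\<in>\<N>. emeasure \<rho> N = 0"
    let ?\<N> = "(\<lambda>N. f -` N \<inter> I) ` \<N>"
    have "emeasure \<pi> (\<Union>?\<N>) = 0"
    proof (rule un)
      show "?\<N> \<subseteq> Pow I" by auto
      have "|?\<N>| <o |f ` I|"
        using card_of_image N(2) by (rule ordLeq_ordLess_trans)
      then show "|?\<N>| <o \<kappa>" using iso' by (rule ordLess_ordIso_trans)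
      show "emeasure \<pi> N' = 0" if "N' \<in> ?\<N>" for N'
      proof -
        from that obtain A where A: "A \<in> \<N>" "N' = f -` A \<inter> I" by blast
        then have "A \<subseteq> f ` I" using N(1) by blast
        from em[OF this] A N(3) show ?thesis by simp
      qed
    qed
    moreover have "\<Union>?\<N> = f -` (\<Union>\<N>) \<inter> I" by auto
    moreover have "\<Union>\<N> \<subseteq> f ` I" using N(1) by blast
    ultimately show "emeasure \<rho> (\<Union>\<N>) = 0"
      by (simp only: em)
  qed
  then show thesis using that iso' by blast
qed

text \<open>A HOL formula can only quantify over cardinals represented on a fixed type. For bounding
  \<open>dens TYPE('b)\<close> the cardinals on \<open>'b\<close> suffice: if \<open>dens TYPE('b)\<close> is smaller than every real-valued
  measurable cardinal on \<open>'b\<close>, then it is smaller than every one on any other type.\<close>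

lemma dens_less_real_valued_measurable:
  fixes \<kappa> :: "'c rel"
  assumes below: "\<And>\<kappa>' :: 'b::topological_space rel. real_valued_measurable \<kappa>' \<Longrightarrow> dens TYPE('b) <o \<kappa>'"
    and rvm: "real_valued_measurable \<kappa>"
  shows "dens TYPE('b) <o \<kappa>"
proof (cases "\<kappa> \<le>o |UNIV :: 'b set|")
  case True
  from real_valued_measurable_copy[OF rvm True]
  obtain \<kappa>' :: "'b rel" where k: "real_valued_measurable \<kappa>'" "\<kappa>' =o \<kappa>" .
  have "dens TYPE('b) <o \<kappa>'" using below[OF k(1)] .
  then show ?thesis using k(2) by (rule ordLess_ordIso_trans)
next
  case False
  have wo: "Well_order \<kappa>"
    using rvm by (simp add: real_valued_measurable_def card_order_on_def)
  then have "|UNIV :: 'b set| <o \<kappa>"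
    using False card_of_Well_order not_ordLeq_iff_ordLess by blast
  moreover obtain D :: "'b set" where "dens TYPE('b) = |D|" by (rule dens_witness)
  then have "dens TYPE('b) \<le>o |UNIV :: 'b set|" by (simp add: card_of_mono1)
  ultimately show ?thesis using ordLeq_ordLess_trans by blast
qed


section \<open>Elementary processes\<close>

text \<open>\<open>\<Xi> = (\<Sum>j=1..N. y j \<cdot> 1\<^bsub>A j\<^esub>)\<close> as a formal sum over a partition of the sample space into
  \<open>\<G>\<close>-measurable, possibly empty cells: \<open>\<Xi> \<omega>\<close> is the value \<open>y j\<close> of the cell containing \<open>\<omega>\<close>.\<close>

definition simple_valued :: "nat \<Rightarrow> 'a measure \<Rightarrow> ('a \<Rightarrow> 'b) \<Rightarrow> bool" where
  "simple_valued N \<G> \<Xi> \<longleftrightarrow>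
     (\<exists>(y :: nat \<Rightarrow> 'b) A.
        (\<forall>j\<in>{1..N}. A j \<in> sets \<G>) \<and> disjoint_family_on A {1..N} \<and>
        (\<Union>j\<in>{1..N}. A j) = space \<G> \<and>
        (\<forall>j\<in>{1..N}. \<forall>\<omega>\<in>A j. \<Xi> \<omega> = y j))"

definition elementary_process ::
  "real \<Rightarrow> (real \<Rightarrow> 'a measure) \<Rightarrow> ('a \<Rightarrow> real \<Rightarrow> 'b) \<Rightarrow> bool" where
  "elementary_process T \<F> Y \<longleftrightarrow>
     (\<exists>(n :: nat) (t :: nat \<Rightarrow> real) (N :: nat) (\<Xi> :: nat \<Rightarrow> 'a \<Rightarrow> 'b).
        t 0 = 0 \<and> t n = T \<and> (\<forall>i<n. t i < t (Suc i)) \<and>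
        (\<forall>i<n. simple_valued N (\<F> (t i)) (\<Xi> i)) \<and>
        (\<forall>\<omega>\<in>space (\<F> 0). Y \<omega> 0 = \<Xi> 0 \<omega> \<and>
           (\<forall>i<n. \<forall>s\<in>{t i<..t (Suc i)}. Y \<omega> s = \<Xi> i \<omega>)))"


section \<open>Real powers of extended nonnegative reals\<close>

text \<open>Intended for exponents \<open>a > 0\<close>.\<close>

definition ennreal_powr :: "ennreal \<Rightarrow> real \<Rightarrow> ennreal" where
  "ennreal_powr x a = (if x = \<infinity> then \<infinity> else ennreal (enn2real x powr a))"

end

theory Submission
  imports Defs
begin

text \<open>There are two approximations. First the values: the law \<open>\<mu>\<close> of \<open>X\<close> under \<open>dt \<otimes> P\<close> is a finite Borel
  measure on \<open>'b\<close>, and the hypothesis on \<open>dens\<close> forces \<open>\<mu>\<close> to be carried by countably many balls of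
  any given radius (\<open>measure_concentrated_on_countably_many_balls\<close>). Otherwise an image of \<open>\<mu>\<close> would
  give a nonzero finite measure that is defined on all subsets of a subset of a dense set \<open>D\<close> of size
  \<open>dens\<close> and vanishes on points, and a family of null sets of least cardinality with non-null union
  would yield a real-valued measurable cardinal at most \<open>dens\<close>
  (\<open>real_valued_measurable_from_measure\<close>). Hence \<open>X\<close> is close in \<open>L\<^sup>p\<close> to \<open>v \<circ> Z\<close> with \<open>Z = k \<circ> X\<close> taking finitely many natural
  numbers as values (\<open>finite_valued_approximation\<close>).

  Second the times. Put \<open>Z = 0\<close> outside \<open>[0, T]\<close> and sample \<open>Z\<close> at the left end points of the grid
  \<open>s + h \<int>\<close>. Averaging over \<open>s \<in> (0, h)\<close>, the expected time during which the sampled process differs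
  from \<open>Z\<close> is at most the supremum over \<open>0 < u \<le> h\<close> of \<open>\<integral> P(Z (v + u) \<noteq> Z v) dv\<close>, which tends to \<open>0\<close> with
  \<open>h\<close> by continuity of translations; so some shift \<open>s\<close> is good (\<open>good_grid_shift\<close>). As \<open>Z\<close> is only
  evaluated at grid points, the sampled process is elementary as soon as each \<open>Z t\<close> is
  \<open>\<F> t\<close>-measurable, and progressive sets have this property as well as adapted ones.

  The two errors combine by \<open>(a + b)\<^sup>p \<le> 2\<^sup>p a\<^sup>p + 2\<^sup>p b\<^sup>p\<close>; the second is bounded by the measure of
  \<open>{Z \<noteq> sampled Z}\<close> times a constant, as only finitely many points of \<open>'b\<close> are involved.\<close>

section \<open>Measures on all subsets of a set\<close>

text \<open>Among the families of null sets with non-null union take one, \<open>\<N>\<close>, of least cardinality, and let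
  \<open>\<phi>\<close> choose for each point of \<open>\<Union>\<N>\<close> a member of \<open>\<N>\<close> containing it. The image under \<open>\<phi>\<close> of \<open>\<pi>\<close>
  conditioned on \<open>\<Union>\<N>\<close> witnesses that \<open>|\<N>|\<close> is real-valued measurable: the fibres of \<open>\<phi>\<close> are null,
  and minimality gives the additivity for families of fewer than \<open>|\<N>|\<close> null sets.\<close>

lemma real_valued_measurable_from_measure:
  fixes \<pi> :: "'i measure"
  assumes "finite_measure \<pi>" and all: "sets \<pi> = Pow (space \<pi>)"
    and pt: "\<And>x. x \<in> space \<pi> \<Longrightarrow> emeasure \<pi> {x} = 0"
    and pos: "emeasure \<pi> (space \<pi>) \<noteq> 0"
  obtains \<kappa> :: "'i set rel" where "real_valued_measurable \<kappa>" "\<kappa> \<le>o |space \<pi>|"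
proof -
  interpret finite_measure \<pi> by fact
  define I where "I = space \<pi>"
  define bad where "bad \<N> \<longleftrightarrow> \<N> \<subseteq> Pow I \<and> (\<forall>N\<in>\<N>. emeasure \<pi> N = 0) \<and> emeasure \<pi> (\<Union>\<N>) \<noteq> 0"
    for \<N>
  let ?singletons = "(\<lambda>x. {x}) ` I"
  have singletons: "bad ?singletons"
    using pos pt by (auto simp: bad_def I_def)
  have "\<exists>r\<in>{ |\<N>| | \<N>. bad \<N>}. \<forall>r'\<in>{ |\<N>| | \<N>. bad \<N>}. r \<le>o r'"
    using singletons by (intro exists_minim_Card_order) (auto intro: card_of_Card_order)
  then obtain \<N> where bad: "bad \<N>" and least: "\<And>\<M>. bad \<M> \<Longrightarrow> |\<N>| \<le>o |\<M>|"
    by blast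
  define U where "U = \<Union>\<N>"
  have U: "U \<subseteq> I" "emeasure \<pi> U \<noteq> 0" "U \<in> sets \<pi>"
    using bad by (auto simp: bad_def U_def all I_def)
  obtain A\<^sub>0 where A0: "A\<^sub>0 \<in> \<N>"
    using U(2) by (cases "\<N> = {}") (auto simp: U_def)
  define \<phi> where "\<phi> x = (if x \<in> U then SOME A. A \<in> \<N> \<and> x \<in> A else A\<^sub>0)" for x
  have \<phi>_U: "\<phi> x \<in> \<N> \<and> x \<in> \<phi> x" if "x \<in> U" for x
    using that someI_ex[of "\<lambda>A. A \<in> \<N> \<and> x \<in> A"] by (auto simp: \<phi>_def U_def)
  have \<phi>_in: "\<phi> x \<in> \<N>" for x
    using \<phi>_U[of x] A0 by (cases "x \<in> U") (auto simp: \<phi>_def)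
  define \<nu> where "\<nu> = uniform_measure \<pi> U"
  define \<rho> where "\<rho> = distr \<nu> (count_space \<N>) \<phi>"
  have meas: "\<phi> \<in> \<nu> \<rightarrow>\<^sub>M count_space \<N>"
    using \<phi>_in by (auto simp: measurable_def \<nu>_def all)
  interpret \<nu>: prob_space \<nu>
    unfolding \<nu>_def using U by (intro prob_space_uniform_measure) (auto simp: emeasure_finite)
  have null_iff: "emeasure \<rho> S = 0 \<longleftrightarrow> emeasure \<pi> (U \<inter> \<phi> -` S) = 0" if "S \<subseteq> \<N>" for S
  proof -
    have "\<phi> -` S \<inter> I \<in> sets \<pi>" by (auto simp: all I_def)
    then have "emeasure \<rho> S = emeasure \<pi> (U \<inter> (\<phi> -` S \<inter> I)) / emeasure \<pi> U"
      unfolding \<rho>_def using that U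
      by (subst emeasure_distr[OF meas]) (auto simp: \<nu>_def I_def)
    moreover have "U \<inter> (\<phi> -` S \<inter> I) = U \<inter> \<phi> -` S" using U by auto
    ultimately show ?thesis
      using U by (simp add: ennreal_divide_eq_0_iff)
  qed
  have "real_valued_measurable |\<N>|"
    unfolding real_valued_measurable_def
  proof (intro conjI exI[of _ \<N>] exI[of _ \<rho>] ballI allI impI)
    show "Card_order |\<N>|" by (rule card_of_Card_order)
    show "|\<N>| =o |\<N>|" by (rule card_of_refl)
    show "prob_space \<rho>" unfolding \<rho>_def by (rule \<nu>.prob_space_distr[OF meas])
    show "space \<rho> = \<N>" "sets \<rho> = Pow \<N>" by (simp_all add: \<rho>_def)
  next
    fix A assume A: "A \<in> \<N>"
    have "U \<inter> \<phi> -` {A} \<subseteq> A" using \<phi>_U by auto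
    moreover have "A \<in> sets \<pi>" "emeasure \<pi> A = 0"
      using A bad by (auto simp: bad_def all I_def)
    ultimately have "emeasure \<pi> (U \<inter> \<phi> -` {A}) = 0"
      by (metis emeasure_mono le_zero_eq)
    then show "emeasure \<rho> {A} = 0" using A by (subst null_iff) auto
  next
    fix \<S> assume \<S>: "\<S> \<subseteq> Pow \<N>" "|\<S>| <o |\<N>|" "\<forall>S\<in>\<S>. emeasure \<rho> S = 0"
    let ?\<M> = "(\<lambda>S. U \<inter> \<phi> -` S) ` \<S>"
    have "|?\<M>| <o |\<N>|"
      using card_of_image \<S>(2) by (rule ordLeq_ordLess_trans)
    then have "\<not> bad ?\<M>"
      using least not_ordLess_ordLeq by blast
    moreover have "\<forall>N\<in>?\<M>. emeasure \<pi> N = 0"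
    proof safe
      fix S assume "S \<in> \<S>"
      then show "emeasure \<pi> (U \<inter> \<phi> -` S) = 0" using \<S> null_iff[of S] by auto
    qed
    moreover have "?\<M> \<subseteq> Pow I" using U by auto
    ultimately have "emeasure \<pi> (\<Union>?\<M>) = 0" by (auto simp: bad_def)
    moreover have "\<Union>?\<M> = U \<inter> \<phi> -` \<Union>\<S>" by auto
    moreover have "\<Union>\<S> \<subseteq> \<N>" using \<S> by auto
    ultimately show "emeasure \<rho> (\<Union>\<S>) = 0" by (simp add: null_iff)
  qed
  moreover have "|\<N>| \<le>o |I|"
    using least[OF singletons] card_of_image by (rule ordLeq_transitive)
  ultimately show thesis using that by (simp add: I_def)
qed

section \<open>Finite Borel measures on metric spaces of small density\<close>

text \<open>Let \<open>\<phi> y\<close> be the least \<open>x \<in> D\<close> with \<open>dist y x < \<delta>\<close>. Points \<open>y\<close>, \<open>z\<close> with \<open>\<phi> y \<noteq> \<phi> z\<close> and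
  \<open>dist y (\<phi> y)\<close>, \<open>dist z (\<phi> z)\<close> at most \<open>\<delta> - \<eta>\<close> are \<open>\<eta>\<close>-separated: the one with the larger index lies
  outside the \<open>\<delta>\<close>-ball of the other. So arbitrary unions of these pieces of the fibres of \<open>\<phi>\<close> are
  closed.\<close>

lemma closed_least_ball_index:
  fixes \<phi> :: "'b::metric_space \<Rightarrow> 'b"
  assumes r: "\<And>x y. (x, y) \<in> r \<Longrightarrow> (y, x) \<in> r \<Longrightarrow> x = y"
    and in_ball: "\<And>y. dist y (\<phi> y) < \<delta>" and in_D: "\<And>y. \<phi> y \<in> D"
    and least: "\<And>x y. x \<in> D \<Longrightarrow> dist y x < \<delta> \<Longrightarrow> (\<phi> y, x) \<in> r"
    and \<eta>: "0 < \<eta>"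
  shows "closed {y. \<phi> y \<in> S \<and> dist y (\<phi> y) \<le> \<delta> - \<eta>}" (is "closed ?E")
  unfolding closed_sequential_limits
proof (intro allI impI, elim conjE)
  have sep: "\<eta> \<le> dist y z"
    if y: "dist y (\<phi> y) \<le> \<delta> - \<eta>" and z: "dist z (\<phi> z) \<le> \<delta> - \<eta>" and ne: "\<phi> y \<noteq> \<phi> z" for y z
  proof (rule ccontr)
    assume less: "\<not> \<eta> \<le> dist y z"
    have "dist z (\<phi> y) < \<delta>" "dist y (\<phi> z) < \<delta>"
      using less y z dist_triangle[of z "\<phi> y" y] dist_triangle[of y "\<phi> z" z]
      by (auto simp: dist_commute)
    then show False using least in_D r ne by metis
  qed
  fix w l assume w: "\<forall>n. w n \<in> ?E" and lim: "w \<longlonglongrightarrow> l"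
  have "\<forall>\<^sub>F n in sequentially. dist (w n) l < \<eta> / 2"
    using lim \<eta> by (intro tendstoD) simp_all
  then obtain m where m: "\<And>n. n \<ge> m \<Longrightarrow> dist (w n) l < \<eta> / 2"
    by (auto simp: eventually_sequentially)
  define x where "x = \<phi> (w m)"
  \<comment> \<open>By separation, the index is constant along a tail of the sequence.\<close>
  have const: "\<phi> (w n) = x" if "n \<ge> m" for n
  proof (rule ccontr)
    assume "\<phi> (w n) \<noteq> x"
    then have "\<eta> \<le> dist (w n) (w m)" using w by (intro sep) (auto simp: x_def)
    moreover have "dist (w n) (w m) \<le> dist (w n) l + dist (w m) l" by (rule dist_triangle2)
    ultimately show False using m[OF that] m[of m] by simp
  qed
  have "\<forall>\<^sub>F n in sequentially. dist (w n) x \<le> \<delta> - \<eta>"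
    using w const by (auto simp: eventually_sequentially intro!: exI[of _ m])
  then have l_x: "dist l x \<le> \<delta> - \<eta>"
    using lim by (intro tendsto_upperbound[OF tendsto_dist[OF lim tendsto_const]]) auto
  have "(\<phi> l, x) \<in> r"
    using l_x \<eta> by (intro least) (auto simp: x_def in_D)
  \<comment> \<open>The open ball around \<open>\<phi> l\<close> contains a tail of the sequence, and points of the tail have least index \<open>x\<close>.\<close>
  moreover have "(x, \<phi> l) \<in> r"
  proof -
    have "(\<lambda>n. dist (w n) (\<phi> l)) \<longlonglongrightarrow> dist l (\<phi> l)"
      using lim by (intro tendsto_intros)
    then have "\<forall>\<^sub>F n in sequentially. dist (w n) (\<phi> l) < \<delta>"
      using in_ball by (rule order_tendstoD)
    then have "\<forall>\<^sub>F n in sequentially. (x, \<phi> l) \<in> r"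
      using eventually_ge_at_top[of m]
    proof eventually_elim
      case (elim n)
      then show ?case using least[OF in_D[of l] elim(1)] const by simp
    qed
    then show ?thesis by simp
  qed
  ultimately have "\<phi> l = x" using r by blast
  then show "l \<in> ?E" using l_x w by (auto simp: x_def)
qed

text \<open>The index \<open>\<phi> y\<close> of the first ball of radius \<open>\<delta>\<close> around a point of \<open>D\<close> that contains \<open>y\<close> is
  measurable for the full power set of \<open>D\<close>. The image of \<open>\<mu>\<close> has countably many atoms, and outside
  them it vanishes because there is no real-valued measurable cardinal up to \<open>|D|\<close>.\<close>

lemma measure_concentrated_on_countably_many_balls:
  fixes \<mu> :: "'b::metric_space measure"
  assumes dens: "\<And>\<kappa> :: 'b rel. real_valued_measurable \<kappa> \<Longrightarrow> dens TYPE('b) <o \<kappa>"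
    and "finite_measure \<mu>" and sets: "sets \<mu> = sets borel" and \<delta>: "0 < \<delta>"
  obtains C where "countable C" "AE y in \<mu>. \<exists>c\<in>C. dist y c < \<delta>"
proof -
  interpret finite_measure \<mu> by fact
  note [measurable_cong] = sets
  have sp: "space \<mu> = UNIV" using sets_eq_imp_space_eq[OF sets] by simp
  obtain D :: "'b set" where D: "closure D = UNIV" "dens TYPE('b) = |D|"
    by (rule dens_witness)
  obtain r :: "'b rel" where "well_order_on UNIV r" using well_order_on by blast
  then have "Well_order r" and field: "Field r = UNIV" using well_order_on_Well_order by blast+
  interpret wo_rel r by unfold_locales fact
  define \<phi> where "\<phi> y = minim {x \<in> D. dist y x < \<delta>}" for y
  have ne: "{x \<in> D. dist y x < \<delta>} \<noteq> {}" for y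
    using D(1) \<delta> closure_approachable[of y D] by (auto simp: dist_commute)
  have \<phi>: "\<phi> y \<in> D \<and> dist y (\<phi> y) < \<delta>" for y
    using minim_in[of "{x \<in> D. dist y x < \<delta>}"] ne[of y] by (auto simp: field \<phi>_def)
  have least: "(\<phi> y, x) \<in> r" if "x \<in> D" "dist y x < \<delta>" for x y
    unfolding \<phi>_def using that by (intro minim_least) (auto simp: field)
  have meas: "\<phi> -` S \<in> sets borel" for S
  proof -
    \<comment> \<open>Every set of indices has an \<open>F\<^sub>\<sigma>\<close> preimage.\<close>
    have "\<phi> -` S = (\<Union>n. {y. \<phi> y \<in> S \<and> dist y (\<phi> y) \<le> \<delta> - 1 / real (Suc n)})"
    proof safe
      fix y assume "\<phi> y \<in> S"
      obtain n where "inverse (real (Suc n)) < \<delta> - dist y (\<phi> y)"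
        using reals_Archimedean[of "\<delta> - dist y (\<phi> y)"] \<phi> by auto
      then show "y \<in> (\<Union>n. {y. \<phi> y \<in> S \<and> dist y (\<phi> y) \<le> \<delta> - 1 / real (Suc n)})"
        using \<open>\<phi> y \<in> S\<close> by (auto simp: inverse_eq_divide intro!: exI[of _ n])
    qed auto
    also have "\<dots> \<in> sets borel"
    proof (intro sets.countable_UN image_subsetI borel_closed)
      fix n
      show "closed {y. \<phi> y \<in> S \<and> dist y (\<phi> y) \<le> \<delta> - 1 / real (Suc n)}"
        by (rule closed_least_ball_index[where r=r and D=D])
           (use ANTISYM \<phi> least in \<open>auto simp: antisym_def\<close>)
    qed
    finally show ?thesis .
  qed
  have \<phi>_meas: "\<phi> \<in> \<mu> \<rightarrow>\<^sub>M count_space D"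
    using meas \<phi> by (auto simp: measurable_def sets sp)
  define \<pi> where "\<pi> = distr \<mu> (count_space D) \<phi>"
  interpret \<pi>: finite_measure \<pi>
    unfolding \<pi>_def by (rule finite_measure_distr[OF \<phi>_meas])
  define C where "C = {x \<in> D. measure \<pi> {x} \<noteq> 0}"
  have C: "countable C"
    using \<pi>.countable_support by (rule countable_subset[rotated]) (auto simp: C_def)
  define \<rho> where "\<rho> = restrict_space \<pi> (D - C)"
  have sets_\<pi>: "sets \<pi> = Pow D" "space \<pi> = D" by (simp_all add: \<pi>_def)
  have sp\<rho>: "space \<rho> = D - C" by (auto simp: \<rho>_def space_restrict_space sets_\<pi>)
  have sets_\<rho>: "sets \<rho> = Pow (D - C)" 
    by (auto simp: \<rho>_def sets_restrict_space sets_\<pi> image_iff)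
  have em\<rho>: "emeasure \<rho> A = emeasure \<pi> A" if "A \<subseteq> D - C" for A
    unfolding \<rho>_def using that by (intro emeasure_restrict_space) (auto simp: sets_\<pi>)
  have "emeasure \<rho> (space \<rho>) = 0"
  proof (rule ccontr)
    assume pos: "emeasure \<rho> (space \<rho>) \<noteq> 0"
    have "finite_measure \<rho>"
      by standard (simp add: em\<rho> sp\<rho> \<pi>.emeasure_finite)
    moreover have "emeasure \<rho> {x} = 0" if "x \<in> space \<rho>" for x
      using that by (subst em\<rho>) (auto simp: sp\<rho> C_def \<pi>.emeasure_eq_measure)
    ultimately obtain \<kappa> :: "'b set rel" where \<kappa>: "real_valued_measurable \<kappa>" "\<kappa> \<le>o |space \<rho>|"
      using real_valued_measurable_from_measure[of \<rho>] pos by (auto simp: sets_\<rho> sp\<rho>)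
    have "|D| <o \<kappa>"
      using dens_less_real_valued_measurable[OF dens \<kappa>(1)] D(2) by simp
    also have "\<kappa> \<le>o |space \<rho>|" by fact
    also have "|space \<rho>| \<le>o |D|" by (rule card_of_mono1) (auto simp: sp\<rho>)
    finally show False using ordLess_irreflexive by blast
  qed
  then have "emeasure \<mu> (\<phi> -` (D - C) \<inter> space \<mu>) = 0"
    using em\<rho>[of "D - C"] by (simp add: sp\<rho> \<pi>_def emeasure_distr[OF \<phi>_meas])
  moreover have "\<phi> -` (D - C) \<inter> space \<mu> \<in> sets \<mu>"
    using meas by (auto simp: sets sp)
  ultimately have "AE y in \<mu>. y \<notin> \<phi> -` (D - C) \<inter> space \<mu>"
    by (intro AE_not_in) auto
  then have "AE y in \<mu>. \<exists>c\<in>C. dist y c < \<delta>"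
    by eventually_elim (use \<phi> sp in auto)
  then show thesis using C that by blast
qed

text \<open>Each point covered by the first \<open>n\<close> balls is replaced by the centre of the first ball containing
  it, all other points by \<open>y\<^sub>0\<close>.\<close>

lemma finite_valued_approximation:
  fixes \<mu> :: "'b::metric_space measure"
  assumes "finite_measure \<mu>" and sets: "sets \<mu> = sets borel"
    and balls: "\<And>\<delta>. 0 < \<delta> \<Longrightarrow> \<exists>C. countable C \<and> (AE y in \<mu>. \<exists>c\<in>C. dist y c < \<delta>)"
    and int: "(\<integral>\<^sup>+y. ennreal (dist y y\<^sub>0 powr p) \<partial>\<mu>) < \<infinity>"
    and p: "0 < p" and \<eta>: "0 < \<eta>"
  obtains k :: "'b \<Rightarrow> nat" and N :: nat and v :: "nat \<Rightarrow> 'b"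
  where "k \<in> borel \<rightarrow>\<^sub>M count_space UNIV" "\<And>y. k y \<le> N"
    "(\<integral>\<^sup>+y. ennreal (dist y (v (k y)) powr p) \<partial>\<mu>) \<le> ennreal \<eta>"
proof -
  interpret finite_measure \<mu> by fact
  note [measurable_cong] = sets
  have sp: "space \<mu> = UNIV" using sets_eq_imp_space_eq[OF sets] by simp
  have dist_meas [measurable]: "(\<lambda>y. dist y a) \<in> borel_measurable borel" for a :: 'b
    by (intro borel_measurable_continuous_onI continuous_intros)
  define m where "m = measure \<mu> (space \<mu>)"
  define \<delta> where "\<delta> = (\<eta> / (2 * (m + 1))) powr (1 / p)"
  have m: "0 \<le> m" by (simp add: m_def)
  have \<delta>: "0 < \<delta>" using \<eta> m by (simp add: \<delta>_def)
  have "\<delta> powr p * m \<le> \<eta> / 2"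
  proof -
    have eq: "\<delta> powr p = \<eta> / (2 * (m + 1))" using p \<eta> m by (simp add: \<delta>_def powr_powr)
    show ?thesis unfolding eq using m \<eta> by (simp add: field_simps)
  qed
  then have "ennreal (\<delta> powr p * m) \<le> ennreal (\<eta> / 2)" by (rule ennreal_leI)
  then have \<delta>_m: "ennreal (\<delta> powr p) * emeasure \<mu> (space \<mu>) \<le> ennreal (\<eta> / 2)"
    by (simp add: emeasure_eq_measure m_def ennreal_mult)
  obtain C where C: "countable C" "AE y in \<mu>. \<exists>c\<in>C. dist y c < \<delta>"
    using balls[OF \<delta>] by blast
  define c where "c = from_nat_into (insert y\<^sub>0 C)"
  have c: "range c = insert y\<^sub>0 C"
    unfolding c_def using C by (intro range_from_nat_into) auto
  define G where "G n = {y. \<forall>i<n. \<not> dist y (c i) < \<delta>}" for n :: nat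
  have G_meas [measurable]: "G n \<in> sets borel" for n
    unfolding G_def by measurable
  define \<nu> where "\<nu> = density \<mu> (\<lambda>y. ennreal (dist y y\<^sub>0 powr p))"
  have \<nu>_G: "emeasure \<nu> (G n) = (\<integral>\<^sup>+y. ennreal (dist y y\<^sub>0 powr p) * indicator (G n) y \<partial>\<mu>)" for n
    unfolding \<nu>_def by (intro emeasure_density) (auto simp: sets)
  have "(\<lambda>n. emeasure \<nu> (G n)) \<longlonglongrightarrow> emeasure \<nu> (\<Inter>n. G n)"
  proof (rule Lim_emeasure_decseq)
    show "range G \<subseteq> sets \<nu>" using G_meas by (auto simp: \<nu>_def sets)
    show "decseq G" by (auto simp: decseq_def G_def)
    show "emeasure \<nu> (G n) \<noteq> \<infinity>" for n
    proof -
      have "emeasure \<nu> (G n) \<le> (\<integral>\<^sup>+y. ennreal (dist y y\<^sub>0 powr p) \<partial>\<mu>)"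
        unfolding \<nu>_G by (intro nn_integral_mono) (auto simp: indicator_def)
      then show ?thesis using int by (auto simp: top_unique)
    qed
  qed
  moreover have "emeasure \<nu> (\<Inter>n. G n) = 0"
  proof -
    have "AE y in \<mu>. y \<notin> (\<Inter>n. G n)"
      using C(2)
    proof eventually_elim
      case (elim y)
      then obtain i where "dist y (c i) < \<delta>" using c by (metis image_iff insertCI)
      then have "y \<notin> G (Suc i)" by (auto simp: G_def)
      then show ?case by blast
    qed
    moreover have [measurable]: "(\<Inter>n. G n) \<in> sets borel" by measurable
    ultimately show ?thesis
      unfolding \<nu>_def
      by (subst emeasure_density) (auto simp: sets nn_integral_0_iff_AE indicator_def)
  qed
  ultimately have "(\<lambda>n. emeasure \<nu> (G n)) \<longlonglongrightarrow> 0" by simp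
  then have "\<forall>\<^sub>F n in sequentially. emeasure \<nu> (G n) < ennreal (\<eta> / 2)"
    using \<eta> by (intro order_tendstoD) auto
  then obtain n where n: "emeasure \<nu> (G n) < ennreal (\<eta> / 2)"
    by (auto simp: eventually_sequentially)
  \<comment> \<open>\<open>G n\<close> is the part not covered by the first \<open>n\<close> balls; the value there is \<open>v 0 = y\<^sub>0\<close>.\<close>
  define k where "k y = (if y \<in> G n then 0 else Suc (LEAST i. dist y (c i) < \<delta>))" for y
  define v where "v = case_nat y\<^sub>0 c"
  have outside: "(LEAST i. dist y (c i) < \<delta>) < n" "dist y (c (LEAST i. dist y (c i) < \<delta>)) < \<delta>"
    if "y \<notin> G n" for y
  proof -
    from that obtain i where i: "i < n" "dist y (c i) < \<delta>" by (auto simp: G_def)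
    then show "(LEAST i. dist y (c i) < \<delta>) < n" using Least_le le_less_trans by metis
    show "dist y (c (LEAST i. dist y (c i) < \<delta>)) < \<delta>" using i(2) by (rule LeastI)
  qed
  have k_meas [measurable]: "k \<in> borel \<rightarrow>\<^sub>M count_space UNIV"
    unfolding k_def by measurable
  moreover have "k y \<le> n" for y using outside(1)[of y] by (auto simp: k_def)
  moreover have "(\<integral>\<^sup>+y. ennreal (dist y (v (k y)) powr p) \<partial>\<mu>) \<le> ennreal \<eta>"
  proof -
    have "ennreal (dist y (v (k y)) powr p)
        \<le> ennreal (\<delta> powr p) + ennreal (dist y y\<^sub>0 powr p) * indicator (G n) y" for y
    proof (cases "y \<in> G n")
      case False
      then have "dist y (v (k y)) powr p \<le> \<delta> powr p"
        using outside(2)[of y] p by (intro powr_mono2) (auto simp: k_def v_def)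
      then show ?thesis using False by (simp add: ennreal_leI)
    qed (simp add: k_def v_def)
    then have "(\<integral>\<^sup>+y. ennreal (dist y (v (k y)) powr p) \<partial>\<mu>)
        \<le> (\<integral>\<^sup>+y. ennreal (\<delta> powr p) + ennreal (dist y y\<^sub>0 powr p) * indicator (G n) y \<partial>\<mu>)"
      by (intro nn_integral_mono)
    also have "\<dots> = ennreal (\<delta> powr p) * emeasure \<mu> (space \<mu>) + emeasure \<nu> (G n)"
      unfolding \<nu>_G by (subst nn_integral_add) auto
    also have "\<dots> \<le> ennreal (\<eta> / 2) + ennreal (\<eta> / 2)"
      using \<delta>_m n by (intro add_mono) auto
    also have "\<dots> = ennreal \<eta>" using \<eta> by (simp flip: ennreal_plus)
    finally show ?thesis .
  qed
  ultimately show thesis by (rule that)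
qed

section \<open>Continuity of translations\<close>

lemma emeasure_lborel_shift:
  fixes u :: real
  assumes [measurable]: "A \<in> sets borel"
  shows "emeasure lborel {v. v + u \<in> A} = emeasure lborel A"
proof -
  have "emeasure lborel A = emeasure (distr lborel borel ((+) u)) A"
    by (simp add: lborel_distr_plus)
  also have "\<dots> = emeasure lborel {v. v + u \<in> A}"
    by (subst emeasure_distr) (auto intro!: arg_cong2[where f=emeasure] simp: add.commute)
  finally show ?thesis by simp
qed

text \<open>By regularity there are a compact \<open>K \<subseteq> B\<close> and an open \<open>U \<supseteq> B\<close> with \<open>U - K\<close> small, and a
  translation by less than the distance of \<open>K\<close> from the complement of \<open>U\<close> maps \<open>K\<close> into \<open>U\<close>.\<close>

lemma translation_continuous_set:
  fixes B :: "real set"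
  assumes [measurable]: "B \<in> sets borel" and bdd: "bounded B"
  shows "((\<lambda>u. emeasure lborel {v. (v + u \<in> B) \<noteq> (v \<in> B)}) \<longlongrightarrow> 0) (at 0)"
proof (rule order_tendstoI)
  fix a :: ennreal assume "0 < a"
  then obtain b where b: "0 < b" "b < a" using dense by blast
  define e where "e = enn2real b / 4"
  have "b < top" using b by (auto intro: order.strict_trans2)
  then have e: "0 < e" "ennreal (4 * e) < a"
    using b by (auto simp: e_def enn2real_positive_iff)
  obtain U where U: "open U" "B \<subseteq> U" "emeasure lborel (U - B) < ennreal e"
    using outer_regular_lborel[of B e] e by auto
  obtain V where V: "open V" "- B \<subseteq> V" "emeasure lborel (V - - B) < ennreal e"
    using outer_regular_lborel[of "- B" e] e by auto
  note [measurable] = borel_open[OF U(1)] borel_open[OF V(1)]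
  have K: "- V \<subseteq> B" using V by auto
  have "compact (- V)"
    using V(1) bounded_subset[OF bdd K] by (simp add: compact_eq_bounded_closed closed_Compl)
  moreover have "- V \<inter> - U = {}" using U K by blast
  ultimately obtain d where d: "0 < d" "\<And>x y. x \<in> - V \<Longrightarrow> y \<in> - U \<Longrightarrow> d \<le> dist x y"
    using separate_compact_closed[of "- V" "- U"] closed_Compl[OF U(1)] by blast
  have "emeasure lborel {v. (v + u \<in> B) \<noteq> (v \<in> B)} < a" if u: "dist u 0 < d" for u
  proof -
    let ?S = "\<lambda>A. {v. v + u \<in> A}"
    have shift: "emeasure lborel (?S (V - - B)) = emeasure lborel (V - - B)"
      "emeasure lborel (?S (U - B)) = emeasure lborel (U - B)"
      by (intro emeasure_lborel_shift; measurable)+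
    have "v \<in> U" if "v + u \<in> - V" for v
      using d(2)[OF that, of v] u by (auto simp: dist_norm)
    moreover have "v + u \<in> U" if "v \<in> - V" for v
      using d(2)[OF that, of "v + u"] u by (auto simp: dist_norm)
    ultimately have "{v. (v + u \<in> B) \<noteq> (v \<in> B)}
        \<subseteq> (?S (V - - B) \<union> (U - B)) \<union> ((V - - B) \<union> ?S (U - B))"
      using U V by auto
    then have "emeasure lborel {v. (v + u \<in> B) \<noteq> (v \<in> B)}
        \<le> emeasure lborel ((?S (V - - B) \<union> (U - B)) \<union> ((V - - B) \<union> ?S (U - B)))"
      by (intro emeasure_mono) auto
    also have "\<dots> \<le> (emeasure lborel (?S (V - - B)) + emeasure lborel (U - B))
        + (emeasure lborel (V - - B) + emeasure lborel (?S (U - B)))"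
      by (intro order_trans[OF emeasure_subadditive] add_mono emeasure_subadditive) auto
    also have "\<dots> \<le> (ennreal e + ennreal e) + (ennreal e + ennreal e)"
      unfolding shift using U(3) V(3) by (intro add_mono less_imp_le)
    also have "\<dots> = ennreal (4 * e)" using e by (simp flip: ennreal_plus)
    finally show ?thesis using e(2) by simp
  qed
  then show "\<forall>\<^sub>F u in at 0. emeasure lborel {v. (v + u \<in> B) \<noteq> (v \<in> B)} < a"
    using d(1) by (auto simp: eventually_at)
qed simp

lemma translation_continuous_step:
  fixes z :: "real \<Rightarrow> nat"
  assumes [measurable]: "z \<in> borel \<rightarrow>\<^sub>M count_space UNIV" and bound: "\<And>t. z t \<le> N"
    and supp: "\<And>t. t \<notin> {0..T} \<Longrightarrow> z t = 0"
  shows "((\<lambda>u. emeasure lborel {v. z (v + u) \<noteq> z v}) \<longlongrightarrow> 0) (at 0)"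
proof (rule tendsto_sandwich[where f="\<lambda>_. 0"])
  let ?B = "\<lambda>j. {t. z t = j}"
  let ?D = "\<lambda>j u. {v. (v + u \<in> ?B j) \<noteq> (v \<in> ?B j)}"
  have "((\<lambda>u. \<Sum>j\<in>{1..N}. emeasure lborel (?D j u)) \<longlongrightarrow> (\<Sum>j\<in>{1..N}. 0)) (at 0)"
  proof (intro tendsto_sum translation_continuous_set)
    fix j assume "j \<in> {1..N}"
    then show "bounded (?B j)"
      using supp by (intro bounded_subset[OF bounded_closed_interval[of 0 T]]) force
  qed measurable
  then show "((\<lambda>u. \<Sum>j\<in>{1..N}. emeasure lborel (?D j u)) \<longlongrightarrow> 0) (at 0)" by simp
  have "emeasure lborel {v. z (v + u) \<noteq> z v} \<le> (\<Sum>j\<in>{1..N}. emeasure lborel (?D j u))" for u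
  proof -
    \<comment> \<open>If two values differ, one of them is nonzero.\<close>
    have "v \<in> (\<Union>j\<in>{1..N}. ?D j u)" if "z (v + u) \<noteq> z v" for v
      using that bound[of v] bound[of "v + u"] by (cases "z v = 0") auto
    then have "emeasure lborel {v. z (v + u) \<noteq> z v} \<le> emeasure lborel (\<Union>j\<in>{1..N}. ?D j u)"
      by (intro emeasure_mono) auto
    also have "\<dots> \<le> (\<Sum>j\<in>{1..N}. emeasure lborel (?D j u))"
      by (intro emeasure_subadditive_finite) auto
    finally show ?thesis .
  qed
  then show "\<forall>\<^sub>F u in at 0. emeasure lborel {v. z (v + u) \<noteq> z v}
      \<le> (\<Sum>j\<in>{1..N}. emeasure lborel (?D j u))"
    by simp
qed auto

lemma pred_neq_nat [measurable (raw)]: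
  fixes f g :: "'a \<Rightarrow> nat"
  assumes [measurable]: "f \<in> M \<rightarrow>\<^sub>M count_space UNIV" "g \<in> M \<rightarrow>\<^sub>M count_space UNIV"
  shows "Measurable.pred M (\<lambda>x. f x \<noteq> g x)"
  by (rule measurable_compose_countable[where f="\<lambda>i x. f x \<noteq> i" and g=g]) measurable

lemma mean_translation_continuous:
  fixes Z :: "real \<Rightarrow> 'a \<Rightarrow> nat"
  assumes "finite_measure P"
    and Z [measurable]: "(\<lambda>(t, \<omega>). Z t \<omega>) \<in> borel \<Otimes>\<^sub>M P \<rightarrow>\<^sub>M count_space UNIV"
    and bound: "\<And>t \<omega>. Z t \<omega> \<le> N" and supp: "\<And>t \<omega>. t \<notin> {0..T} \<Longrightarrow> Z t \<omega> = 0" and T: "0 \<le> T"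
  shows "((\<lambda>u. \<integral>\<^sup>+v. emeasure P {\<omega> \<in> space P. Z (v + u) \<omega> \<noteq> Z v \<omega>} \<partial>lborel) \<longlongrightarrow> 0) (at_right 0)"
proof -
  interpret finite_measure P by fact
  interpret LP: pair_sigma_finite lborel P
    by (intro pair_sigma_finite.intro lborel.sigma_finite_measure_axioms sigma_finite_measure_axioms)
  have meas [measurable]: "(\<lambda>(v, \<omega>). indicator {v. Z (v + u) \<omega> \<noteq> Z v \<omega>} v :: ennreal)
      \<in> borel_measurable (lborel \<Otimes>\<^sub>M P)" for u
  proof -
    have "(\<lambda>x. (fst x + u, snd x)) \<in> borel \<Otimes>\<^sub>M P \<rightarrow>\<^sub>M borel \<Otimes>\<^sub>M P" by measurable
    from measurable_compose[OF this Z]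
    have [measurable]: "(\<lambda>x. Z (fst x + u) (snd x)) \<in> borel \<Otimes>\<^sub>M P \<rightarrow>\<^sub>M count_space UNIV" by simp
    have [measurable]: "(\<lambda>x. Z (fst x) (snd x)) \<in> borel \<Otimes>\<^sub>M P \<rightarrow>\<^sub>M count_space UNIV"
      using Z by (simp add: case_prod_unfold)
    have "(\<lambda>x. if Z (fst x + u) (snd x) \<noteq> Z (fst x) (snd x) then 1 else 0 :: ennreal)
        \<in> borel_measurable (borel \<Otimes>\<^sub>M P)"
      by measurable
    then show ?thesis by (simp add: indicator_def case_prod_unfold)
  qed
  have Z' [measurable]: "(\<lambda>v. Z v \<omega>) \<in> borel \<rightarrow>\<^sub>M count_space UNIV" if "\<omega> \<in> space P" for \<omega>
    using measurable_compose[OF measurable_Pair2'[OF that] Z] by simp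
  have swap: "(\<integral>\<^sup>+v. emeasure P {\<omega> \<in> space P. Z (v + u) \<omega> \<noteq> Z v \<omega>} \<partial>lborel)
      = (\<integral>\<^sup>+\<omega>. emeasure lborel {v. Z (v + u) \<omega> \<noteq> Z v \<omega>} \<partial>P)" for u
  proof -
    have "(\<integral>\<^sup>+v. emeasure P {\<omega> \<in> space P. Z (v + u) \<omega> \<noteq> Z v \<omega>} \<partial>lborel)
        = (\<integral>\<^sup>+v. (\<integral>\<^sup>+\<omega>. indicator {v. Z (v + u) \<omega> \<noteq> Z v \<omega>} v \<partial>P) \<partial>lborel)"
    proof (intro nn_integral_cong)
      fix v
      have [measurable]: "Z t \<in> P \<rightarrow>\<^sub>M count_space UNIV" for t
        using measurable_compose[OF measurable_Pair1'[of t borel] Z] by simp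
      have "emeasure P {\<omega> \<in> space P. Z (v + u) \<omega> \<noteq> Z v \<omega>}
          = (\<integral>\<^sup>+\<omega>. indicator {\<omega> \<in> space P. Z (v + u) \<omega> \<noteq> Z v \<omega>} \<omega> \<partial>P)"
        by (intro nn_integral_indicator[symmetric]) measurable
      then show "emeasure P {\<omega> \<in> space P. Z (v + u) \<omega> \<noteq> Z v \<omega>}
          = (\<integral>\<^sup>+\<omega>. indicator {v. Z (v + u) \<omega> \<noteq> Z v \<omega>} v \<partial>P)"
        by (auto intro!: nn_integral_cong simp: indicator_def)
    qed
    also have "\<dots> = (\<integral>\<^sup>+\<omega>. (\<integral>\<^sup>+v. indicator {v. Z (v + u) \<omega> \<noteq> Z v \<omega>} v \<partial>lborel) \<partial>P)"
      using LP.Fubini'[OF meas] by simp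
    also have "\<dots> = (\<integral>\<^sup>+\<omega>. emeasure lborel {v. Z (v + u) \<omega> \<noteq> Z v \<omega>} \<partial>P)"
      by (intro nn_integral_cong nn_integral_indicator) simp
    finally show ?thesis .
  qed
  show ?thesis
    unfolding swap
  proof (rule tendsto_at_right_sequentially[of 0 1])
    fix S :: "nat \<Rightarrow> real" assume S: "\<And>n. 0 < S n" "S \<longlonglongrightarrow> 0"
    have "(\<lambda>n. \<integral>\<^sup>+\<omega>. emeasure lborel {v. Z (v + S n) \<omega> \<noteq> Z v \<omega>} \<partial>P) \<longlonglongrightarrow> (\<integral>\<^sup>+\<omega>. 0 \<partial>P)"
    proof (rule nn_integral_dominated_convergence[where w="\<lambda>_. ennreal (2 * T)"])
      show "(\<lambda>\<omega>. emeasure lborel {v. Z (v + S n) \<omega> \<noteq> Z v \<omega>}) \<in> borel_measurable P" for n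
      proof -
        have "(\<lambda>\<omega>. \<integral>\<^sup>+v. indicator {v. Z (v + S n) \<omega> \<noteq> Z v \<omega>} v \<partial>lborel) \<in> borel_measurable P"
          using meas by measurable
        moreover have "(\<integral>\<^sup>+v. indicator {v. Z (v + S n) \<omega> \<noteq> Z v \<omega>} v \<partial>lborel)
            = emeasure lborel {v. Z (v + S n) \<omega> \<noteq> Z v \<omega>}" if "\<omega> \<in> space P" for \<omega>
          using that by (intro nn_integral_indicator) simp
        ultimately show ?thesis by (simp cong: measurable_cong)
      qed
      have "emeasure lborel {v. Z (v + S n) \<omega> \<noteq> Z v \<omega>} \<le> ennreal (2 * T)" for n \<omega>
      proof -
        have "{v. Z (v + S n) \<omega> \<noteq> Z v \<omega>} \<subseteq> {0..T} \<union> {v. v + S n \<in> {0..T}}"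
          using supp by force
        then have "emeasure lborel {v. Z (v + S n) \<omega> \<noteq> Z v \<omega>}
            \<le> emeasure lborel ({0..T} \<union> {v. v + S n \<in> {0..T}})"
          by (intro emeasure_mono) measurable
        also have "\<dots> \<le> emeasure lborel {0..T} + emeasure lborel {v. v + S n \<in> {0..T}}"
          by (intro emeasure_subadditive) measurable
        also have "emeasure lborel {v. v + S n \<in> {0..T}} = emeasure lborel {0..T}"
          by (rule emeasure_lborel_shift) simp
        also have "emeasure lborel {0..T} = ennreal T" using T by simp
        also have "ennreal T + ennreal T = ennreal (2 * T)"
          using T by (subst ennreal_plus[symmetric]) simp_all
        finally show ?thesis .
      qed
      then show "AE \<omega> in P. emeasure lborel {v. Z (v + S n) \<omega> \<noteq> Z v \<omega>} \<le> ennreal (2 * T)" for n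
        by simp
      show "AE \<omega> in P. (\<lambda>n. emeasure lborel {v. Z (v + S n) \<omega> \<noteq> Z v \<omega>}) \<longlonglongrightarrow> 0"
      proof (rule AE_I2)
        fix \<omega> assume "\<omega> \<in> space P"
        then have "((\<lambda>u. emeasure lborel {v. Z (v + u) \<omega> \<noteq> Z v \<omega>}) \<longlongrightarrow> 0) (at 0)"
          using bound supp by (intro translation_continuous_step[of "\<lambda>t. Z t \<omega>" N T]) auto
        moreover have "filterlim S (at 0) sequentially"
          unfolding filterlim_at using S(2) order.strict_implies_not_eq[OF S(1)]
          by (auto intro!: always_eventually simp del: eventually_sequentially)
        ultimately show "(\<lambda>n. emeasure lborel {v. Z (v + S n) \<omega> \<noteq> Z v \<omega>}) \<longlonglongrightarrow> 0"
          by (rule filterlim_compose)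
      qed
      show "(\<integral>\<^sup>+\<omega>. ennreal (2 * T) \<partial>P) < \<infinity>"
        by (simp add: emeasure_eq_measure ennreal_mult_less_top)
    qed auto
    then show "(\<lambda>n. \<integral>\<^sup>+\<omega>. emeasure lborel {v. Z (v + S n) \<omega> \<noteq> Z v \<omega>} \<partial>P) \<longlonglongrightarrow> 0" by simp
  qed simp
qed

section \<open>Choice of a grid\<close>

text \<open>The largest point of the grid \<open>s + h \<int>\<close> that is strictly less than \<open>t\<close>. Strictness matches the
  half-open intervals \<open>(t\<^sub>i, t\<^sub>i\<^sub>+\<^sub>1]\<close> on which elementary processes are constant.\<close>

definition grid_floor :: "real \<Rightarrow> real \<Rightarrow> real \<Rightarrow> real" where
  "grid_floor h s t = s + (of_int \<lceil>(t - s) / h\<rceil> - 1) * h"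

lemma grid_floor_eq:
  assumes "0 < h" "s + (real i - 1) * h < t" "t \<le> s + real i * h"
  shows "grid_floor h s t = s + (real i - 1) * h"
proof -
  have "real i - 1 < (t - s) / h" "(t - s) / h \<le> real i"
    using assms by (simp_all add: field_simps)
  then have "\<lceil>(t - s) / h\<rceil> = int i" by (simp add: ceiling_eq_iff)
  then show ?thesis by (simp add: grid_floor_def)
qed

lemma grid_floor_measurable [measurable]: "grid_floor h s \<in> borel_measurable borel"
  unfolding grid_floor_def by measurable

text \<open>For fixed \<open>s\<close> the integral splits into cells \<open>(a i + s, a i + s + h]\<close> with \<open>a i = (i - 1) h\<close>, and integrating over
  \<open>s \<in> (0, h)\<close> and exchanging with the position \<open>u \<in> (0, h]\<close> inside the cell turns the sum over the
  cells into an integral over all left end points \<open>v\<close>. The factor \<open>2\<close> leaves room for choosing a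
  single \<open>s\<close> from the bound on the average.\<close>

lemma good_grid_shift:
  fixes H :: "real \<Rightarrow> real \<Rightarrow> ennreal"
  assumes [measurable]: "(\<lambda>(t, r). H t r) \<in> borel_measurable (borel \<Otimes>\<^sub>M borel)"
    and h: "0 < h" and \<eta>: "0 < \<eta>"
    and small: "\<And>u. 0 < u \<Longrightarrow> u \<le> h \<Longrightarrow> (\<integral>\<^sup>+v. H (v + u) v \<partial>lborel) \<le> ennreal \<eta>"
  obtains s where "0 < s" "s < h"
    "(\<integral>\<^sup>+t\<in>{0..real n * h}. H t (grid_floor h s t) \<partial>lborel) \<le> ennreal (2 * \<eta>)"
proof -
  define a where "a i = (real i - 1) * h" for i :: nat
  define Err where "Err s = (\<Sum>i\<le>n. \<integral>\<^sup>+u. H (a i + s + u) (a i + s) * indicator {0<..h} u \<partial>lborel)" for s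
  have [measurable]: "Err \<in> borel_measurable borel"
    unfolding Err_def by measurable
  have Err: "(\<integral>\<^sup>+t\<in>{0..real n * h}. H t (grid_floor h s t) \<partial>lborel) \<le> Err s"
    if s: "0 < s" "s < h" for s
  proof -
    have pointwise: "H t (grid_floor h s t) * indicator {0..real n * h} t
        \<le> (\<Sum>i\<le>n. H t (a i + s) * indicator {a i + s<..a i + s + h} t)" for t
    proof (cases "t \<in> {0..real n * h}")
      case True
      define i where "i = nat \<lceil>(t - s) / h\<rceil>"
      have "- 1 < (t - s) / h" using True s h by (simp add: field_simps)
      then have i: "int i = \<lceil>(t - s) / h\<rceil>" by (simp add: i_def)
      have "(t - s) / h \<le> real n" using True s h by (simp add: field_simps)
      then have "i \<le> n" by (simp add: i_def nat_le_iff ceiling_le_iff)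
      have "real i - 1 < (t - s) / h" "(t - s) / h \<le> real i"
        using i ceiling_correct[of "(t - s) / h"] by (simp_all flip: i)
      then have t: "s + (real i - 1) * h < t" "t \<le> s + real i * h"
        using h by (simp_all add: field_simps)
      have "H t (grid_floor h s t) * indicator {0..real n * h} t
          = H t (a i + s) * indicator {a i + s<..a i + s + h} t"
        using True t h by (simp add: grid_floor_eq[OF h t] a_def algebra_simps)
      also have "\<dots> \<le> (\<Sum>i\<le>n. H t (a i + s) * indicator {a i + s<..a i + s + h} t)"
        using \<open>i \<le> n\<close> by (intro member_le_sum) auto
      finally show ?thesis .
    qed simp
    have "(\<integral>\<^sup>+t\<in>{0..real n * h}. H t (grid_floor h s t) \<partial>lborel)
        \<le> (\<integral>\<^sup>+t. (\<Sum>i\<le>n. H t (a i + s) * indicator {a i + s<..a i + s + h} t) \<partial>lborel)"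
      by (intro nn_integral_mono pointwise)
    also have "\<dots> = (\<Sum>i\<le>n. \<integral>\<^sup>+t. H t (a i + s) * indicator {a i + s<..a i + s + h} t \<partial>lborel)"
      by (intro nn_integral_sum) measurable
    also have "\<dots> = Err s"
      unfolding Err_def
    proof (intro sum.cong refl)
      fix i
      show "(\<integral>\<^sup>+t. H t (a i + s) * indicator {a i + s<..a i + s + h} t \<partial>lborel)
          = (\<integral>\<^sup>+u. H (a i + s + u) (a i + s) * indicator {0<..h} u \<partial>lborel)"
        by (subst nn_integral_real_affine[where c=1 and t="a i + s"])
           (auto intro!: nn_integral_cong simp: indicator_def)
    qed
    finally show ?thesis .
  qed
  have "(\<integral>\<^sup>+s. Err s * indicator {0<..<h} s \<partial>lborel)
      = (\<Sum>i\<le>n. \<integral>\<^sup>+s. \<integral>\<^sup>+u. H (a i + s + u) (a i + s) * indicator {0<..h} u * indicator {0<..<h} s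
           \<partial>lborel \<partial>lborel)"
    unfolding Err_def sum_distrib_right
    by (subst nn_integral_sum) (auto intro!: sum.cong nn_integral_cong nn_integral_multc[symmetric])
  also have "\<dots> = (\<Sum>i\<le>n. \<integral>\<^sup>+u. \<integral>\<^sup>+s. H (a i + s + u) (a i + s) * indicator {0<..h} u * indicator {0<..<h} s
           \<partial>lborel \<partial>lborel)"
    by (intro sum.cong refl lborel_pair.Fubini'[symmetric]) measurable
  also have "\<dots> = (\<Sum>i\<le>n. \<integral>\<^sup>+u. (\<integral>\<^sup>+v. H (v + u) v * indicator {a i<..<a i + h} v \<partial>lborel)
           * indicator {0<..h} u \<partial>lborel)"
  proof (intro sum.cong nn_integral_cong refl)
    fix i u
    have "(\<integral>\<^sup>+v. H (v + u) v * indicator {a i<..<a i + h} v \<partial>lborel)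
        = (\<integral>\<^sup>+s. H (a i + s + u) (a i + s) * indicator {0<..<h} s \<partial>lborel)"
      by (subst nn_integral_real_affine[where c=1 and t="a i"])
         (auto intro!: nn_integral_cong simp: indicator_def)
    then show "(\<integral>\<^sup>+s. H (a i + s + u) (a i + s) * indicator {0<..h} u * indicator {0<..<h} s \<partial>lborel)
        = (\<integral>\<^sup>+v. H (v + u) v * indicator {a i<..<a i + h} v \<partial>lborel) * indicator {0<..h} u"
      by (auto simp: indicator_def)
  qed
  also have "\<dots> = (\<integral>\<^sup>+u. (\<integral>\<^sup>+v. (\<Sum>i\<le>n. H (v + u) v * indicator {a i<..<a i + h} v) \<partial>lborel)
           * indicator {0<..h} u \<partial>lborel)"
    by (simp add: nn_integral_sum[symmetric] sum_distrib_right[symmetric])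
  also have "\<dots> \<le> (\<integral>\<^sup>+u. ennreal \<eta> * indicator {0<..h} u \<partial>lborel)"
  proof (intro nn_integral_mono)
    fix u
    have disj: "(\<Sum>i\<le>n. H (v + u) v * indicator {a i<..<a i + h} v) \<le> H (v + u) v" for v
    proof -
      have unique: "i = j" if "w \<in> {a i<..<a i + h}" "w \<in> {a j<..<a j + h}" for i j w
      proof -
        have "real i - 1 < w / h" "w / h < real i" "real j - 1 < w / h" "w / h < real j"
          using that h by (simp_all add: a_def field_simps)
        then show ?thesis by linarith
      qed
      have "disjoint_family_on (\<lambda>i. {a i<..<a i + h}) {..n}"
        using unique unfolding disjoint_family_on_def by blast
      then have "(\<Sum>i\<le>n. indicator {a i<..<a i + h} v :: ennreal)
          = indicator (\<Union>i\<le>n. {a i<..<a i + h}) v"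
        by (intro indicator_UN_disjoint[symmetric]) auto
      then have "(\<Sum>i\<le>n. indicator {a i<..<a i + h} v) \<le> (1 :: ennreal)"
        by (simp add: indicator_def)
      then show ?thesis
        unfolding sum_distrib_left[symmetric] using mult_left_mono[of _ 1 "H (v + u) v"] by fastforce
    qed
    show "(\<integral>\<^sup>+v. (\<Sum>i\<le>n. H (v + u) v * indicator {a i<..<a i + h} v) \<partial>lborel) * indicator {0<..h} u
        \<le> ennreal \<eta> * indicator {0<..h} u"
    proof (cases "u \<in> {0<..h}")
      case True
      have "(\<integral>\<^sup>+v. (\<Sum>i\<le>n. H (v + u) v * indicator {a i<..<a i + h} v) \<partial>lborel)
          \<le> (\<integral>\<^sup>+v. H (v + u) v \<partial>lborel)"
        by (intro nn_integral_mono disj)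
      also have "\<dots> \<le> ennreal \<eta>" using True by (intro small) auto
      finally show ?thesis using True by simp
    qed simp
  qed
  also have "\<dots> = ennreal (\<eta> * h)"
    using h \<eta> by (simp add: nn_integral_cmult_indicator ennreal_mult)
  finally have mean: "(\<integral>\<^sup>+s. Err s * indicator {0<..<h} s \<partial>lborel) \<le> ennreal (\<eta> * h)" .
  have "\<exists>s\<in>{0<..<h}. Err s \<le> ennreal (2 * \<eta>)"
  proof (rule ccontr)
    assume "\<not> ?thesis"
    then have "(\<integral>\<^sup>+s. ennreal (2 * \<eta>) * indicator {0<..<h} s \<partial>lborel)
        \<le> (\<integral>\<^sup>+s. Err s * indicator {0<..<h} s \<partial>lborel)"
      by (intro nn_integral_mono) (auto simp: indicator_def not_le intro: less_imp_le)
    also have "(\<integral>\<^sup>+s. ennreal (2 * \<eta>) * indicator {0<..<h} s \<partial>lborel) = ennreal (2 * \<eta> * h)"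
      using h \<eta> by (subst nn_integral_cmult_indicator) (simp_all flip: ennreal_mult)
    finally have "ennreal (2 * \<eta> * h) \<le> ennreal (\<eta> * h)" using mean by (rule order_trans)
    then show False using mult_pos_pos[OF \<eta> h] by (simp add: ennreal_le_iff2)
  qed
  then show thesis using Err that by (meson greaterThanLessThan_iff order_trans)
qed

section \<open>Sampling an adapted finite-valued process\<close>

lemma (in filtered_prob_space) section_prog_sets:
  assumes A: "A \<in> prog_sets P T \<F>" and t: "t \<in> {0..T}"
  shows "{\<omega>. (t, \<omega>) \<in> A} \<in> sets (\<F> t)"
proof -
  let ?B = "restrict_space borel {0..T} \<Otimes>\<^sub>M P"
  have "A \<subseteq> space ?B" using A sets.sets_into_space[of A ?B] by (auto simp: prog_sets_def)
  then have eq: "{\<omega>. (t, \<omega>) \<in> A} = Pair t -` (A \<inter> ({0..t} \<times> space P))"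
    using t by (auto simp: space_pair_measure)
  have "A \<inter> ({0..t} \<times> space P) \<in> sets (restrict_space borel {0..t} \<Otimes>\<^sub>M \<F> t)"
    using A t by (auto simp: prog_sets_def)
  then show ?thesis unfolding eq by (rule sets_Pair1)
qed

lemma (in filtered_prob_space) adapted_sets_of_prog_sets:
  "prog_sets P T \<F> \<subseteq> adapted_sets P T \<F>"
  using section_prog_sets by (auto simp: adapted_sets_def prog_sets_def)

context filtered_prob_space
begin

text \<open>The partition consists of \<open>0\<close>, the grid points \<open>g i = s + (i - 1) h\<close> for \<open>1 \<le> i \<le> n\<close>, and \<open>T\<close>. On the first
  interval the sampling point is \<open>g 0 < 0\<close>, where \<open>Z = 0\<close>, so the value there is a constant.\<close>

lemma elementary_process_grid:
  fixes Z :: "real \<Rightarrow> 'a \<Rightarrow> nat" and v :: "nat \<Rightarrow> 'b"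
  assumes n: "0 < n" and T: "T = real n * h" and s: "0 < s" "s < h"
    and bound: "\<And>t \<omega>. Z t \<omega> \<le> N" and supp: "\<And>t \<omega>. t \<notin> {0..T} \<Longrightarrow> Z t \<omega> = 0"
    and adapted: "\<And>t j. t \<in> {0..T} \<Longrightarrow> {\<omega> \<in> space P. Z t \<omega> = j} \<in> sets (\<F> t)"
  shows "elementary_process T \<F> (\<lambda>\<omega> t. v (Z (grid_floor h s t) \<omega>))"
proof -
  have h: "0 < h" using s by simp
  define g where "g i = s + (real i - 1) * h" for i :: nat
  define \<tau> where "\<tau> i = (if i = 0 then 0 else if i \<le> n then g i else T)" for i
  have g_less: "g i < g (Suc i)" for i using h by (simp add: g_def algebra_simps)
  have g_neg: "g 0 < 0" using s by (simp add: g_def)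
  have g_pos: "0 < g i" if "0 < i" for i
    using that s h by (auto simp: g_def intro!: add_pos_nonneg)
  have g_T: "g i < T" if "i \<le> n" for i
  proof -
    have "g i \<le> s + (real n - 1) * h" using that h by (simp add: g_def)
    also have "\<dots> < T" using s by (simp add: T algebra_simps)
    finally show ?thesis .
  qed
  have T_g: "T < g (Suc n)" using s by (simp add: g_def T)
  have \<tau>_range: "\<tau> i \<in> {0..T}" for i
    using g_pos[of i] g_T[of i] h n by (auto simp: \<tau>_def T)
  have g_\<tau>: "g i \<le> \<tau> i" if "i < Suc n" for i
    using that g_neg by (auto simp: \<tau>_def)
  have \<tau>_g: "\<tau> (Suc i) \<le> g (Suc i)" if "i < Suc n" for i
    using that T_g by (auto simp: \<tau>_def less_Suc_eq)
  show ?thesis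
    unfolding elementary_process_def
  proof (rule exI[of _ "Suc n"], rule exI[of _ \<tau>], rule exI[of _ "Suc N"],
      rule exI[of _ "\<lambda>i \<omega>. v (Z (g i) \<omega>)"], intro conjI allI ballI impI)
    show "\<tau> 0 = 0" "\<tau> (Suc n) = T" by (simp_all add: \<tau>_def)
    show "\<tau> i < \<tau> (Suc i)" if "i < Suc n" for i
      using that g_less[of i] g_pos[of "Suc i"] g_T[of i] n by (auto simp: \<tau>_def not_le less_Suc_eq)
    show "simple_valued (Suc N) (\<F> (\<tau> i)) (\<lambda>\<omega>. v (Z (g i) \<omega>))" if i: "i < Suc n" for i
      unfolding simple_valued_def
      \<comment> \<open>The cells are numbered from \<open>1\<close>, the values of \<open>Z\<close> from \<open>0\<close>.\<close>
    proof (intro exI[of _ "\<lambda>j. v (j - 1)"] exI[of _ "\<lambda>j. {\<omega> \<in> space P. Z (g i) \<omega> = j - 1}"] conjI ballI)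
      have sp: "space (\<F> (\<tau> i)) = space P" using \<tau>_range by (rule space_filt)
      show "{\<omega> \<in> space P. Z (g i) \<omega> = j - 1} \<in> sets (\<F> (\<tau> i))" for j
      proof (cases "i = 0")
        case True
        then have "Z (g i) \<omega> = 0" for \<omega> using supp g_neg by auto
        then have "{\<omega> \<in> space P. Z (g i) \<omega> = j - 1} = (if j - 1 = 0 then space (\<F> (\<tau> i)) else {})"
          unfolding sp by auto
        then show ?thesis by simp
      next
        case False
        then have "g i = \<tau> i" using i by (simp add: \<tau>_def)
        then show ?thesis using adapted[OF \<tau>_range[of i]] by simp
      qed
      show "disjoint_family_on (\<lambda>j. {\<omega> \<in> space P. Z (g i) \<omega> = j - 1}) {1..Suc N}"
        by (auto simp: disjoint_family_on_def)
      show "(\<Union>j\<in>{1..Suc N}. {\<omega> \<in> space P. Z (g i) \<omega> = j - 1}) = space (\<F> (\<tau> i))"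
      proof -
        have "\<omega> \<in> (\<Union>j\<in>{1..Suc N}. {\<omega> \<in> space P. Z (g i) \<omega> = j - 1})" if "\<omega> \<in> space P" for \<omega>
          using that bound[of "g i" \<omega>] by (auto intro!: bexI[of _ "Suc (Z (g i) \<omega>)"])
        then show ?thesis by (auto simp: sp)
      qed
      show "v (Z (g i) \<omega>) = v (j - 1)" if "\<omega> \<in> {\<omega> \<in> space P. Z (g i) \<omega> = j - 1}" for j \<omega>
        using that by simp
    qed
    have grid: "grid_floor h s t = g i" if "g i < t" "t \<le> g (Suc i)" for t i
      using grid_floor_eq[OF h, of s i t] that by (simp add: g_def)
    show "v (Z (grid_floor h s 0) \<omega>) = v (Z (g 0) \<omega>)" for \<omega>
      using g_neg g_pos[of 1] by (subst grid[of 0 0]) auto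
    show "v (Z (grid_floor h s t) \<omega>) = v (Z (g i) \<omega>)"
      if "i < Suc n" "t \<in> {\<tau> i<..\<tau> (Suc i)}" for i t \<omega>
      using that g_\<tau>[of i] \<tau>_g[of i] by (subst grid[of i t]) auto
  qed
qed

lemma elementary_approximation_finite_valued:
  fixes Z :: "real \<Rightarrow> 'a \<Rightarrow> nat"
  assumes T: "0 < T"
    and Z [measurable]: "(\<lambda>(t, \<omega>). Z t \<omega>) \<in> borel \<Otimes>\<^sub>M P \<rightarrow>\<^sub>M count_space UNIV"
    and bound: "\<And>t \<omega>. Z t \<omega> \<le> N" and supp: "\<And>t \<omega>. t \<notin> {0..T} \<Longrightarrow> Z t \<omega> = 0"
    and adapted: "\<And>t j. t \<in> {0..T} \<Longrightarrow> {\<omega> \<in> space P. Z t \<omega> = j} \<in> sets (\<F> t)"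
    and \<eta>: "0 < \<eta>"
  obtains \<rho> :: "real \<Rightarrow> real" where "\<rho> \<in> borel_measurable borel"
    "\<And>v :: nat \<Rightarrow> 'b. elementary_process T \<F> (\<lambda>\<omega> t. v (Z (\<rho> t) \<omega>))"
    "(\<integral>\<^sup>+t\<in>{0..T}. emeasure P {\<omega> \<in> space P. Z t \<omega> \<noteq> Z (\<rho> t) \<omega>} \<partial>lborel) \<le> ennreal \<eta>"
proof -
  define H where "H t r = emeasure P {\<omega> \<in> space P. Z t \<omega> \<noteq> Z r \<omega>}" for t r
  have H_meas: "(\<lambda>(t, r). H t r) \<in> borel_measurable (borel \<Otimes>\<^sub>M borel)"
  proof -
    have 1: "(\<lambda>x. (fst (fst x), snd x)) \<in> (borel \<Otimes>\<^sub>M borel) \<Otimes>\<^sub>M P \<rightarrow>\<^sub>M borel \<Otimes>\<^sub>M P"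
      and 2: "(\<lambda>x. (snd (fst x), snd x)) \<in> (borel \<Otimes>\<^sub>M borel) \<Otimes>\<^sub>M P \<rightarrow>\<^sub>M borel \<Otimes>\<^sub>M P"
      by measurable
    have [measurable]:
      "(\<lambda>x. Z (fst (fst x)) (snd x)) \<in> (borel \<Otimes>\<^sub>M borel) \<Otimes>\<^sub>M P \<rightarrow>\<^sub>M count_space UNIV"
      "(\<lambda>x. Z (snd (fst x)) (snd x)) \<in> (borel \<Otimes>\<^sub>M borel) \<Otimes>\<^sub>M P \<rightarrow>\<^sub>M count_space UNIV"
      using measurable_compose[OF 1 Z] measurable_compose[OF 2 Z] by simp_all
    have "(\<lambda>x. \<integral>\<^sup>+\<omega>. (if Z (fst x) \<omega> \<noteq> Z (snd x) \<omega> then 1 else 0) \<partial>P)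
        \<in> borel_measurable (borel \<Otimes>\<^sub>M borel)"
      by (rule borel_measurable_nn_integral) (simp add: case_prod_unfold)
    moreover have "H t r = (\<integral>\<^sup>+\<omega>. (if Z t \<omega> \<noteq> Z r \<omega> then 1 else 0) \<partial>P)" for t r
    proof -
      have [measurable]: "Z t \<in> P \<rightarrow>\<^sub>M count_space UNIV" for t
        using measurable_compose[OF measurable_Pair1'[of t borel] Z] by simp
      have "H t r = (\<integral>\<^sup>+\<omega>. indicator {\<omega> \<in> space P. Z t \<omega> \<noteq> Z r \<omega>} \<omega> \<partial>P)"
        unfolding H_def by (intro nn_integral_indicator[symmetric]) measurable
      then show ?thesis by (auto intro!: nn_integral_cong simp: indicator_def)
    qed
    ultimately show ?thesis by (simp add: case_prod_unfold)
  qed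
  have "((\<lambda>u. \<integral>\<^sup>+v. H (v + u) v \<partial>lborel) \<longlongrightarrow> 0) (at_right 0)"
    unfolding H_def
    using mean_translation_continuous[OF finite_measure_axioms Z bound supp] T by simp
  then have "\<forall>\<^sub>F u in at_right 0. (\<integral>\<^sup>+v. H (v + u) v \<partial>lborel) < ennreal (\<eta> / 2)"
    using \<eta> by (intro order_tendstoD) auto
  then obtain b where b: "0 < b" "\<And>u. 0 < u \<Longrightarrow> u < b \<Longrightarrow> (\<integral>\<^sup>+v. H (v + u) v \<partial>lborel) < ennreal (\<eta> / 2)"
    by (auto simp: eventually_at_right_field)
  obtain n :: nat where n: "T / b < real n" using reals_Archimedean2 by blast
  define h where "h = T / real n"
  have n0: "0 < n" using n T b by (cases n) (auto simp: field_simps)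
  have h: "0 < h" "h < b" "T = real n * h"
    using n n0 T b by (simp_all add: h_def field_simps)
  obtain s where s: "0 < s" "s < h"
    "(\<integral>\<^sup>+t\<in>{0..real n * h}. H t (grid_floor h s t) \<partial>lborel) \<le> ennreal (2 * (\<eta> / 2))"
    using good_grid_shift[OF H_meas h(1), of "\<eta> / 2" n] \<eta> b(2) h(2) by (force intro: less_imp_le)
  show thesis
  proof (rule that[of "grid_floor h s"])
    show "elementary_process T \<F> (\<lambda>\<omega> t. v (Z (grid_floor h s t) \<omega>))" for v :: "nat \<Rightarrow> 'b"
      using elementary_process_grid[OF n0 h(3) s(1,2)] bound supp adapted by blast
  qed (use s(3) h(3) in \<open>simp_all add: H_def\<close>)
qed

end

section \<open>Approximation by elementary processes\<close>

lemma sets_restrict_pair_subset: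
  assumes "A \<in> sets M"
  shows "sets (restrict_space M A \<Otimes>\<^sub>M N) \<subseteq> sets (M \<Otimes>\<^sub>M N)"
proof -
  let ?R = "restrict_space (M \<Otimes>\<^sub>M N) (A \<times> space N)"
  have AN: "A \<times> space N \<in> sets (M \<Otimes>\<^sub>M N)" using assms by auto
  have A: "A \<subseteq> space M" using assms by (rule sets.sets_into_space)
  have "fst \<in> ?R \<rightarrow>\<^sub>M restrict_space M A"
    by (intro measurable_restrict_space2 measurable_restrict_space1 measurable_fst)
       (auto simp: space_restrict_space space_pair_measure)
  moreover have "snd \<in> ?R \<rightarrow>\<^sub>M N"
    by (intro measurable_restrict_space1 measurable_snd)
  ultimately have id: "(\<lambda>x. (fst x, snd x)) \<in> ?R \<rightarrow>\<^sub>M restrict_space M A \<Otimes>\<^sub>M N"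
    by (rule measurable_Pair)
  show ?thesis
  proof
    fix S assume S: "S \<in> sets (restrict_space M A \<Otimes>\<^sub>M N)"
    have "S \<subseteq> space ?R"
      using sets.sets_into_space[OF S] A by (auto simp: space_restrict_space space_pair_measure)
    then have "S \<in> sets ?R" using measurable_sets[OF id S] by (simp add: Int_absorb2)
    then show "S \<in> sets (M \<Otimes>\<^sub>M N)"
      using AN by (auto simp: sets_restrict_space)
  qed
qed

lemma powr_add_le:
  fixes a b p :: real
  assumes "0 \<le> a" "0 \<le> b" "0 < p"
  shows "(a + b) powr p \<le> 2 powr p * a powr p + 2 powr p * b powr p"
proof -
  have "(a + b) powr p \<le> (2 * max a b) powr p"
    using assms by (intro powr_mono2) auto
  also have "\<dots> = 2 powr p * max a b powr p" using assms by (simp add: powr_mult)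
  also have "\<dots> \<le> 2 powr p * a powr p + 2 powr p * b powr p" by (auto simp: max_def)
  finally show ?thesis .
qed

theorem theorem4p5:
  fixes P :: "'a measure" and T :: real and \<F> :: "real \<Rightarrow> 'a measure"
    and M :: "(real \<times> 'a) measure"
    and X :: "'a \<Rightarrow> real \<Rightarrow> 'b::metric_space"
    and p \<epsilon> :: real
  assumes "0 < T"
    and "filtered_prob_space P T \<F>"
    and "1 \<le> p"
    and "M = prog_algebra P T \<F> \<or> usual_conditions P T \<F> \<and> M = adapted_algebra P T \<F>"
    and "\<forall>\<kappa> :: 'b rel. real_valued_measurable \<kappa> \<longrightarrow> dens TYPE('b) <o \<kappa>"
    and "(\<lambda>(t, \<omega>). X \<omega> t) \<in> M \<rightarrow>\<^sub>M borel"
    and "\<exists>y\<^sub>0. (\<integral>\<^sup>+\<omega>. (\<integral>\<^sup>+t\<in>{0..T}. ennreal (dist (X \<omega> t) y\<^sub>0 powr p) \<partial>lborel) \<partial>P) < \<infinity>"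
    and "0 < \<epsilon>"
  shows "\<exists>Y. elementary_process T \<F> Y \<and>
           ennreal_powr
             (\<integral>\<^sup>+\<omega>. (\<integral>\<^sup>+t\<in>{0..T}. ennreal (dist (X \<omega> t) (Y \<omega> t) powr p) \<partial>lborel) \<partial>P) (1 / p)
           \<le> ennreal \<epsilon>"
proof -
  interpret filtered_prob_space P T \<F> by fact
  have p: "0 < p" using \<open>1 \<le> p\<close> by simp
  let ?B = "restrict_space borel {0..T} \<Otimes>\<^sub>M P"
  have sp_B: "space ?B = {0..T} \<times> space P"
    by (simp add: space_pair_measure space_restrict_space)
  have space_M: "space M = {0..T} \<times> space P"
    using assms(4) space_prog_algebra space_adapted_algebra by auto
  have "sets M \<subseteq> adapted_sets P T \<F>"
    using assms(4) sets_prog_algebra sets_adapted_algebra adapted_sets_of_prog_sets by auto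
  then have X_adapted: "(\<lambda>(t, \<omega>). X \<omega> t) -` A \<inter> ({0..T} \<times> space P) \<in> adapted_sets P T \<F>"
    if "A \<in> sets borel" for A
    using measurable_sets[OF assms(6) that] by (auto simp: space_M)
  have X_B [measurable]: "(\<lambda>(t, \<omega>). X \<omega> t) \<in> ?B \<rightarrow>\<^sub>M borel"
    using X_adapted by (intro measurableI) (auto simp: sp_B adapted_sets_def)
  define L where "L = restrict_space lborel {0..T}"
  have "finite_measure L"
    by standard (simp add: L_def emeasure_restrict_space space_restrict_space emeasure_lborel_Icc_eq)
  then interpret L: finite_measure L .
  interpret LP: pair_sigma_finite L P
    by (intro pair_sigma_finite.intro L.sigma_finite_measure_axioms sigma_finite_measure_axioms)
  have sets_L [measurable_cong]: "sets L = sets (restrict_space borel {0..T})"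
    by (simp add: L_def sets_restrict_space)
  have sp_L: "space L = {0..T}" by (simp add: L_def space_restrict_space)
  have int_L: "(\<integral>\<^sup>+t. f t \<partial>L) = (\<integral>\<^sup>+t\<in>{0..T}. f t \<partial>lborel)" for f
    unfolding L_def by (simp add: nn_integral_restrict_space)
  define Q where "Q = L \<Otimes>\<^sub>M P"
  have Fubini_Q: "(\<integral>\<^sup>+x. f x \<partial>Q) = (\<integral>\<^sup>+\<omega>. (\<integral>\<^sup>+t\<in>{0..T}. f (t, \<omega>) \<partial>lborel) \<partial>P)"
    if "f \<in> borel_measurable Q" for f
    using LP.nn_integral_snd[of f] that by (simp add: Q_def int_L)
  have sets_Q [measurable_cong]: "sets Q = sets ?B"
    unfolding Q_def by (intro sets_pair_measure_cong sets_L) simp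
  have X_Q [measurable]: "(\<lambda>(t, \<omega>). X \<omega> t) \<in> Q \<rightarrow>\<^sub>M borel"
    using X_B by measurable
  have "finite_measure Q"
    unfolding Q_def by (intro finite_measure_pair_measure L.finite_measure_axioms finite_measure_axioms)
  then interpret Q: finite_measure Q .
  \<comment> \<open>The law of \<open>X\<close> under \<open>dt \<otimes> P\<close>.\<close>
  define \<mu> where "\<mu> = distr Q borel (\<lambda>(t, \<omega>). X \<omega> t)"
  have \<mu>: "finite_measure \<mu>" "sets \<mu> = sets borel"
    unfolding \<mu>_def by (intro Q.finite_measure_distr X_Q) simp
  have int_\<mu>: "(\<integral>\<^sup>+y. f y \<partial>\<mu>) = (\<integral>\<^sup>+\<omega>. (\<integral>\<^sup>+t\<in>{0..T}. f (X \<omega> t) \<partial>lborel) \<partial>P)"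
    if [measurable]: "f \<in> borel_measurable borel" for f
    unfolding \<mu>_def by (subst nn_integral_distr) (simp_all add: Fubini_Q case_prod_unfold)
  have dist_meas [measurable]: "(\<lambda>y. dist y a) \<in> borel_measurable borel" for a :: 'b
    by (intro borel_measurable_continuous_onI continuous_intros)
  obtain y\<^sub>0 where y0: "(\<integral>\<^sup>+y. ennreal (dist y y\<^sub>0 powr p) \<partial>\<mu>) < \<infinity>"
    using assms(7) by (auto simp: int_\<mu>)
  have balls: "\<exists>C. countable C \<and> (AE y in \<mu>. \<exists>c\<in>C. dist y c < \<delta>)" if "0 < \<delta>" for \<delta>
  proof -
    have "dens TYPE('b) <o \<kappa>" if "real_valued_measurable \<kappa>" for \<kappa> :: "'b rel"
      using assms(5) that by blast
    from measure_concentrated_on_countably_many_balls[OF this \<mu> that]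
    show ?thesis by blast
  qed
  \<comment> \<open>Half of \<open>\<epsilon>\<^sup>p\<close> for each of the two approximations, after division by \<open>2\<^sup>p\<close>.\<close>
  define \<eta> where "\<eta> = \<epsilon> powr p / (2 * 2 powr p)"
  have \<eta>: "0 < \<eta>" using assms(8) by (simp add: \<eta>_def)
  obtain k :: "'b \<Rightarrow> nat" and v :: "nat \<Rightarrow> 'b" and N :: nat where k [measurable]: "k \<in> borel \<rightarrow>\<^sub>M count_space UNIV"
    and k_le: "\<And>y. k y \<le> N"
    and k_int: "(\<integral>\<^sup>+y. ennreal (dist y (v (k y)) powr p) \<partial>\<mu>) \<le> ennreal \<eta>"
    by (rule finite_valued_approximation[OF \<mu> balls y0 p \<eta>]) (assumption | rule that)+
  define Z where "Z t \<omega> = (if t \<in> {0..T} then k (X \<omega> t) else 0)" for t \<omega>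
  have Z [measurable]: "(\<lambda>(t, \<omega>). Z t \<omega>) \<in> borel \<Otimes>\<^sub>M P \<rightarrow>\<^sub>M count_space UNIV"
  proof (rule measurableI)
    fix A :: "nat set" assume "A \<in> sets (count_space UNIV)"
    then have "(\<lambda>(t, \<omega>). k (X \<omega> t)) -` A \<inter> space ?B \<in> sets ?B"
      by (intro measurable_sets[where A="count_space UNIV"]) measurable
    then have "(\<lambda>(t, \<omega>). k (X \<omega> t)) -` A \<inter> space ?B \<in> sets (borel \<Otimes>\<^sub>M P)"
      using sets_restrict_pair_subset[of "{0..T}" borel P] by auto
    moreover have "(- {0..T}) \<times> space P \<in> sets (borel \<Otimes>\<^sub>M P)" by auto
    moreover have "(\<lambda>(t, \<omega>). Z t \<omega>) -` A \<inter> space (borel \<Otimes>\<^sub>M P)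
        = ((\<lambda>(t, \<omega>). k (X \<omega> t)) -` A \<inter> space ?B) \<union> (if 0 \<in> A then (- {0..T}) \<times> space P else {})"
      by (auto simp: Z_def sp_B space_pair_measure split: if_splits)
    ultimately show "(\<lambda>(t, \<omega>). Z t \<omega>) -` A \<inter> space (borel \<Otimes>\<^sub>M P) \<in> sets (borel \<Otimes>\<^sub>M P)"
      by simp
  qed simp
  have Z_le: "Z t \<omega> \<le> N" for t \<omega> using k_le by (simp add: Z_def)
  have Z_supp: "Z t \<omega> = 0" if "t \<notin> {0..T}" for t \<omega> using that by (auto simp: Z_def)
  have Z_adapted: "{\<omega> \<in> space P. Z t \<omega> = j} \<in> sets (\<F> t)" if t: "t \<in> {0..T}" for t j
  proof -
    have "k -` {j} \<in> sets borel" using measurable_sets[OF k, of "{j}"] by simp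
    from X_adapted[OF this] t
    have "{\<omega>. (t, \<omega>) \<in> (\<lambda>(t, \<omega>). X \<omega> t) -` (k -` {j}) \<inter> ({0..T} \<times> space P)} \<in> sets (\<F> t)"
      by (auto simp: adapted_sets_def)
    also have "{\<omega>. (t, \<omega>) \<in> (\<lambda>(t, \<omega>). X \<omega> t) -` (k -` {j}) \<inter> ({0..T} \<times> space P)}
        = {\<omega> \<in> space P. Z t \<omega> = j}"
      using t by (auto simp: Z_def)
    finally show ?thesis .
  qed
  \<comment> \<open>A bound for the \<open>p\<close>-th power of the error wherever \<open>Z\<close> and its sampled version differ.\<close>
  define d where "d = Max ((\<lambda>(i, j). dist (v i) (v j) powr p) ` ({..N} \<times> {..N}))"
  have d: "dist (v i) (v j) powr p \<le> d" if "i \<le> N" "j \<le> N" for i j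
    unfolding d_def using that by (intro Max_ge) auto
  have d0: "0 \<le> d" using d[of 0 0] by simp
  have \<eta>_d: "0 < \<eta> / (d + 1)" using \<eta> d0 by (intro divide_pos_pos) auto
  obtain \<rho> :: "real \<Rightarrow> real" where \<rho> [measurable]: "\<rho> \<in> borel_measurable borel"
    and elem: "\<And>v :: nat \<Rightarrow> 'b. elementary_process T \<F> (\<lambda>\<omega> t. v (Z (\<rho> t) \<omega>))"
    and mism: "(\<integral>\<^sup>+t\<in>{0..T}. emeasure P {\<omega> \<in> space P. Z t \<omega> \<noteq> Z (\<rho> t) \<omega>} \<partial>lborel)
        \<le> ennreal (\<eta> / (d + 1))"
    by (rule elementary_approximation_finite_valued[OF assms(1) Z Z_le Z_supp Z_adapted \<eta>_d])
      (assumption | rule that)+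
  define bad where "bad x = (if Z (fst x) (snd x) \<noteq> Z (\<rho> (fst x)) (snd x) then 1 else 0 :: ennreal)" for x
  have bad_meas: "bad \<in> borel_measurable (borel \<Otimes>\<^sub>M P)"
  proof -
    have "(\<lambda>x. (\<rho> (fst x), snd x)) \<in> borel \<Otimes>\<^sub>M P \<rightarrow>\<^sub>M borel \<Otimes>\<^sub>M P" by measurable
    from measurable_compose[OF this Z]
    have [measurable]: "(\<lambda>x. Z (\<rho> (fst x)) (snd x)) \<in> borel \<Otimes>\<^sub>M P \<rightarrow>\<^sub>M count_space UNIV" by simp
    have [measurable]: "(\<lambda>x. Z (fst x) (snd x)) \<in> borel \<Otimes>\<^sub>M P \<rightarrow>\<^sub>M count_space UNIV"
      using Z by (simp add: case_prod_unfold)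
    show ?thesis unfolding bad_def by measurable
  qed
  have bad_Q [measurable]: "bad \<in> borel_measurable Q"
  proof -
    have "fst \<in> Q \<rightarrow>\<^sub>M L" "snd \<in> Q \<rightarrow>\<^sub>M P" unfolding Q_def by simp_all
    moreover have "(\<lambda>t. t) \<in> L \<rightarrow>\<^sub>M borel" unfolding L_def by (intro measurable_restrict_space1) simp
    ultimately have "(\<lambda>x. (fst x, snd x)) \<in> Q \<rightarrow>\<^sub>M borel \<Otimes>\<^sub>M P"
      by (intro measurable_Pair) (auto dest: measurable_compose)
    then show ?thesis using measurable_compose[OF _ bad_meas] by simp
  qed
  have bad_int: "(\<integral>\<^sup>+x. bad x \<partial>Q) \<le> ennreal (\<eta> / (d + 1))"
  proof -
    have "(\<integral>\<^sup>+x. bad x \<partial>Q) = (\<integral>\<^sup>+t. \<integral>\<^sup>+\<omega>. bad (t, \<omega>) \<partial>P \<partial>L)"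
      unfolding Q_def using bad_Q by (intro nn_integral_fst[symmetric]) (simp add: Q_def)
    also have "\<dots> = (\<integral>\<^sup>+t. emeasure P {\<omega> \<in> space P. Z t \<omega> \<noteq> Z (\<rho> t) \<omega>} \<partial>L)"
    proof (intro nn_integral_cong)
      fix t
      have [measurable]: "Z t \<in> P \<rightarrow>\<^sub>M count_space UNIV" for t
        using measurable_compose[OF measurable_Pair1'[of t borel] Z] by simp
      have "emeasure P {\<omega> \<in> space P. Z t \<omega> \<noteq> Z (\<rho> t) \<omega>}
          = (\<integral>\<^sup>+\<omega>. indicator {\<omega> \<in> space P. Z t \<omega> \<noteq> Z (\<rho> t) \<omega>} \<omega> \<partial>P)"
        by (intro nn_integral_indicator[symmetric]) measurable
      then show "(\<integral>\<^sup>+\<omega>. bad (t, \<omega>) \<partial>P) = emeasure P {\<omega> \<in> space P. Z t \<omega> \<noteq> Z (\<rho> t) \<omega>}"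
        by (auto intro!: nn_integral_cong simp: indicator_def bad_def)
    qed
    finally show ?thesis using mism by (simp add: int_L)
  qed
  define c where "c = (2 :: real) powr p"
  have c: "0 < c" by (simp add: c_def)
  define I where
    "I = (\<integral>\<^sup>+\<omega>. (\<integral>\<^sup>+t\<in>{0..T}. ennreal (dist (X \<omega> t) (v (Z (\<rho> t) \<omega>)) powr p) \<partial>lborel) \<partial>P)"
  have k_dist_meas [measurable]: "(\<lambda>y. dist y (v (k y))) \<in> borel_measurable borel"
    by (rule measurable_compose_countable[where f="\<lambda>i y. dist y (v i)" and g=k]) measurable
  define F where "F x = ennreal c * ennreal (dist (X (snd x) (fst x)) (v (k (X (snd x) (fst x)))) powr p)
      + ennreal (c * d) * bad x" for x
  have X_Q' [measurable]: "(\<lambda>x. X (snd x) (fst x)) \<in> Q \<rightarrow>\<^sub>M borel"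
    using X_Q by (simp add: case_prod_unfold)
  have "I \<le> (\<integral>\<^sup>+\<omega>. (\<integral>\<^sup>+t\<in>{0..T}. F (t, \<omega>) \<partial>lborel) \<partial>P)"
    unfolding I_def
  proof (intro nn_integral_mono)
    fix \<omega> t
    show "ennreal (dist (X \<omega> t) (v (Z (\<rho> t) \<omega>)) powr p) * indicator {0..T} t
        \<le> F (t, \<omega>) * indicator {0..T} t"
    proof (cases "t \<in> {0..T}")
      case True
      let ?a = "dist (X \<omega> t) (v (k (X \<omega> t)))" and ?b = "dist (v (Z t \<omega>)) (v (Z (\<rho> t) \<omega>))"
      have "dist (X \<omega> t) (v (Z (\<rho> t) \<omega>)) \<le> ?a + ?b"
        using True dist_triangle[of "X \<omega> t" "v (Z (\<rho> t) \<omega>)" "v (Z t \<omega>)"] by (simp add: Z_def)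
      then have "dist (X \<omega> t) (v (Z (\<rho> t) \<omega>)) powr p \<le> (?a + ?b) powr p"
        using p by (intro powr_mono2) auto
      also have "\<dots> \<le> c * ?a powr p + c * ?b powr p"
        unfolding c_def using p by (intro powr_add_le) auto
      finally have "ennreal (dist (X \<omega> t) (v (Z (\<rho> t) \<omega>)) powr p)
          \<le> ennreal c * ennreal (?a powr p) + ennreal (c * ?b powr p)"
        using c by (simp add: ennreal_leI flip: ennreal_mult ennreal_plus)
      also have "ennreal (c * ?b powr p) \<le> ennreal (c * d) * bad (t, \<omega>)"
        using d[OF Z_le Z_le] c by (auto simp: bad_def intro!: ennreal_leI)
      finally show ?thesis using True by (simp add: F_def)
    qed simp
  qed
  also have "\<dots> = (\<integral>\<^sup>+x. F x \<partial>Q)"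
    by (intro Fubini_Q[symmetric]) (simp add: F_def)
  also have "\<dots> = ennreal c * (\<integral>\<^sup>+x. ennreal (dist (X (snd x) (fst x)) (v (k (X (snd x) (fst x)))) powr p) \<partial>Q)
      + ennreal (c * d) * (\<integral>\<^sup>+x. bad x \<partial>Q)"
    unfolding F_def by (simp add: nn_integral_add nn_integral_cmult)
  also have "(\<integral>\<^sup>+x. ennreal (dist (X (snd x) (fst x)) (v (k (X (snd x) (fst x)))) powr p) \<partial>Q)
      = (\<integral>\<^sup>+y. ennreal (dist y (v (k y)) powr p) \<partial>\<mu>)"
    unfolding \<mu>_def by (subst nn_integral_distr) (simp_all add: case_prod_unfold)
  also have "ennreal c * \<dots> + ennreal (c * d) * (\<integral>\<^sup>+x. bad x \<partial>Q)
      \<le> ennreal c * ennreal \<eta> + ennreal (c * d) * ennreal (\<eta> / (d + 1))"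
    by (intro add_mono mult_left_mono k_int bad_int) auto
  also have "\<dots> = ennreal (c * \<eta> + c * d * (\<eta> / (d + 1)))"
    using c d0 \<eta> by (simp flip: ennreal_mult ennreal_plus)
  also have "\<dots> \<le> ennreal (\<epsilon> powr p)"
  proof (rule ennreal_leI)
    have "d * (\<eta> / (d + 1)) \<le> \<eta>" using d0 \<eta> by (simp add: field_simps)
    then have "c * (d * (\<eta> / (d + 1))) \<le> c * \<eta>" using c by (intro mult_left_mono) auto
    moreover have "2 * (c * \<eta>) = \<epsilon> powr p" by (simp add: \<eta>_def c_def)
    ultimately show "c * \<eta> + c * d * (\<eta> / (d + 1)) \<le> \<epsilon> powr p" by (simp add: mult.assoc)
  qed
  finally have I: "I \<le> ennreal (\<epsilon> powr p)" .
  then have "I \<noteq> \<infinity>" by (auto simp: top_unique)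
  moreover have "enn2real I powr (1 / p) \<le> \<epsilon>"
  proof -
    have "enn2real I \<le> \<epsilon> powr p" using I by (intro enn2real_leI) auto
    then have "enn2real I powr (1 / p) \<le> (\<epsilon> powr p) powr (1 / p)"
      using p by (intro powr_mono2) auto
    then show ?thesis using p assms(8) by (simp add: powr_powr)
  qed
  ultimately have "ennreal_powr I (1 / p) \<le> ennreal \<epsilon>"
    by (simp add: ennreal_powr_def ennreal_leI)
  then show ?thesis using elem[of v] unfolding I_def by blast
qed

end
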